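(* Let $\{(N_k,B_k)\}_{k=1}^\infty$ be a sequence of admissible pairs such that the infinite convolution $$\mu = \delta_{N_{1}^{-1} B_1} * \delta_{(N_1 N_2)^{-1} B_2} * \cdots * \delta_{(N_1 N_2 \cdots N_k)^{-1} B_k } * \cdots$$ exists, and for $n\ge 1$ let $$\nu_{>n}=\delta_{N_{n+1}^{-1} B_{n+1}} * \delta_{(N_{n+1} N_{n+2})^{-1} B_{n+2}} * \cdots .$$ Suppose that (i) there exists a subsequence $\{\nu_{>n_j}\}$ of $\{\nu_{>n}\}$ that converges weakly to some Borel probability measure on $\mathbb{R}$; (ii) the set $\bigcup_{k=1}^\infty N_k\,\mathcal{O}(M_{B_k})$ is discrete; (iii) for each $k\ge 1$, $\gcd\left(\bigcup_{j=k}^\infty (B_j-B_j)\right)=1$. Then $\mathcal{Z}(\mu)=\emptyset$.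
   Context: For a finite nonempty set $A\subset\mathbb{R}$, $\delta_A=\frac{1}{\#A}\sum_{a\in A}\delta_a$, where $\delta_a$ is the Dirac measure at $a$; $cA=\{ca: a\in A\}$. A Borel probability measure $\mu$ on $\mathbb{R}$ is a spectral measure if there is a set $\Lambda\subset\mathbb{R}$, called a spectrum of $\mu$, such that $\{e^{2\pi i\lambda x}:\lambda\in\Lambda\}$ is an orthonormal basis of $L^2(\mu)$. Given an integer $N$ with $|N|\ge 2$ and a finite set $B\subset\mathbb{Z}$ with $\#B\ge 2$, $(N,B)$ is an admissible pair if the discrete measure $\delta_{N^{-1}B}$ admits a spectrum $L\subset\mathbb{Z}$, i.e. the matrix $\left(\frac{1}{\sqrt{\#B}}e^{-2\pi i b\ell/N}\right)_{b\in B,\ell\in L}$ is unitary. An infinite convolution exists if its finite partial convolutions converge weakly (against bounded continuous functions) to a Borel probability measure, which is then the infinite convolution. For a finite set $B\subset\mathbb{Z}$, $M_B(\xi)=\frac{1}{\#B}\sum_{b\in B}e^{-2\pi i b\xi}$. For $f:\mathbb{R}\to\mathbb{C}$, $\mathcal{O}(f)=\{x\in\mathbb{R}:f(x)=0\}$. A set $A\subset\mathbb{R}$ is discrete if it has no accumulation points, i.e. $[-h,h]\cap A$ is finite for every $h>0$. $B-B=\{b-b':b,b'\in B\}$, and $\gcd$ of a set of integers is the greatest common divisor of all its elements. The Fourier transform is $\widehat{\mu}(\xi)=\int_{\mathbb{R}}e^{-2\pi i\xi x}\,d\mu(x)$, and $\mathcal{Z}(\mu)=\{\xi\in\mathbb{R}:\widehat{\mu}(\xi+k)=0\text{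 for all }k\in\mathbb{Z}\}$. *)

theory Defs
  imports "HOL-Probability.Probability"
begin

text \<open>Borel probability measures on \<open>\<real>\<close> are described by the locale predicate
  \<^const>\<open>real_distribution\<close>.\<close>

section \<open>Uniform measures on finite sets\<close>

text \<open>For finite nonempty \<open>A\<close>, the Borel measure \<open>(1 / #A) \<Sum>\<^sub>a \<delta>\<^sub>a\<close>.\<close>

definition unif_dirac :: "real set \<Rightarrow> real measure" where
  "unif_dirac A = distr (measure_pmf (pmf_of_set A)) borel (\<lambda>x. x)"

lemma emeasure_unif_dirac:
  assumes "finite A" "A \<noteq> {}" "X \<in> sets borel"
  shows "emeasure (unif_dirac A) X = ennreal (card (A \<inter> X) / card A)"
  using assms by (simp add: unif_dirac_def emeasure_distr emeasure_pmf_of_set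
    divide_ennreal[symmetric] ennreal_of_nat_eq_real_of_nat card_gt_0_iff)

lemma real_distribution_unif_dirac: "real_distribution (unif_dirac A)"
  unfolding unif_dirac_def
  by (rule prob_space.real_distribution_distr) (auto simp: measure_pmf.prob_space_axioms)

section \<open>Spectra and admissible pairs\<close>

definition square_integrable :: "real measure \<Rightarrow> (real \<Rightarrow> complex) \<Rightarrow> bool" where
  "square_integrable M f \<longleftrightarrow>
     f \<in> borel_measurable M \<and> integrable M (\<lambda>x. (cmod (f x))\<^sup>2)"

text \<open>The exponentials \<open>x \<mapsto> e\<^bsup>2\<pi>i\<lambda>x\<^esup>\<close>, \<open>\<lambda> \<in> \<Lambda>\<close>, form an orthonormal basis of \<open>L\<^sup>2(M)\<close>: they are an
  orthonormal family and their linear span is dense. Orthonormality refers to the family indexed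
  by \<open>\<Lambda>\<close>, so different frequencies give different elements of \<open>L\<^sup>2(M)\<close>.\<close>

definition is_spectrum :: "real measure \<Rightarrow> real set \<Rightarrow> bool" where
  "is_spectrum M \<Lambda> \<longleftrightarrow>
     (\<forall>l\<in>\<Lambda>. \<forall>l'\<in>\<Lambda>.
        (CLINT x|M. iexp (2 * pi * l * x) * cnj (iexp (2 * pi * l' * x))) = (if l = l' then 1 else 0)) \<and>
     (\<forall>f \<epsilon>. square_integrable M f \<longrightarrow> \<epsilon> > 0 \<longrightarrow>
        (\<exists>F c. finite F \<and> F \<subseteq> \<Lambda> \<and>
           (LINT x|M. (cmod (f x - (\<Sum>l\<in>F. c l * iexp (2 * pi * l * x))))\<^sup>2) < \<epsilon>))"

definition admissible_pair :: "int \<Rightarrow> int set \<Rightarrow> bool" where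
  "admissible_pair N B \<longleftrightarrow>
     \<bar>N\<bar> \<ge> 2 \<and> finite B \<and> card B \<ge> 2 \<and>
     (\<exists>L :: int set.
        is_spectrum (unif_dirac ((\<lambda>b. inverse (real_of_int N) * real_of_int b) ` B)) (real_of_int ` L))"

section \<open>Weak convergence and infinite convolutions\<close>

definition converges_weakly :: "(nat \<Rightarrow> real measure) \<Rightarrow> real measure \<Rightarrow> bool" where
  "converges_weakly M_seq M \<longleftrightarrow>
     (\<forall>f :: real \<Rightarrow> real. continuous_on UNIV f \<and> bounded (range f) \<longrightarrow>
        (\<lambda>n. integral\<^sup>L (M_seq n) f) \<longlonglongrightarrow> integral\<^sup>L M f)"

lemma converges_weakly_iff_weak_conv_m:
  assumes "\<And>n. real_distribution (M_seq n)" "real_distribution M"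
  shows "converges_weakly M_seq M \<longleftrightarrow> weak_conv_m M_seq M"
proof
  assume "converges_weakly M_seq M"
  then show "weak_conv_m M_seq M"
    by (intro integral_bdd_continuous_conv_imp_weak_conv assms)
       (auto simp: converges_weakly_def continuous_on_eq_continuous_at bounded_iff)
next
  assume w: "weak_conv_m M_seq M"
  show "converges_weakly M_seq M"
    unfolding converges_weakly_def
  proof (intro allI impI)
    fix f :: "real \<Rightarrow> real"
    assume f: "continuous_on UNIV f \<and> bounded (range f)"
    then obtain C where "\<And>x. norm (f x) \<le> C"
      by (auto simp: bounded_iff)
    with f show "(\<lambda>n. integral\<^sup>L (M_seq n) f) \<longlonglongrightarrow> integral\<^sup>L M f"
      by (intro weak_conv_imp_integral_bdd_continuous_conv[where B = C] assms w)
         (auto simp: continuous_on_eq_continuous_at)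
  qed
qed

lemma converges_weakly_unique:
  assumes "converges_weakly S M" "converges_weakly S M'"
    and "real_distribution M" "real_distribution M'"
  shows "M = M'"
proof -
  have "converges_weakly (\<lambda>_. M) M'"
    unfolding converges_weakly_def
  proof (intro allI impI)
    fix f :: "real \<Rightarrow> real"
    assume "continuous_on UNIV f \<and> bounded (range f)"
    then have "(\<lambda>n. integral\<^sup>L (S n) f) \<longlonglongrightarrow> integral\<^sup>L M f"
      "(\<lambda>n. integral\<^sup>L (S n) f) \<longlonglongrightarrow> integral\<^sup>L M' f"
      using assms(1,2) by (auto simp: converges_weakly_def)
    then show "(\<lambda>n. integral\<^sup>L M f) \<longlonglongrightarrow> integral\<^sup>L M' f"
      using LIMSEQ_unique by fastforce
  qed
  then have "weak_conv_m (\<lambda>_. M) M'"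
    using assms(3,4) by (simp add: converges_weakly_iff_weak_conv_m)
  then have "(\<lambda>_. char M t) \<longlonglongrightarrow> char M' t" for t
    using assms(3,4) levy_continuity1[of "\<lambda>_. M" M' t] by simp
  then have "char M = char M'"
    by (auto simp: LIMSEQ_const_iff)
  then show ?thesis
    using assms(3,4) Levy_uniqueness by blast
qed

text \<open>\<open>partial_conv m n = m 0 \<star> \<dots> \<star> m n\<close>\<close>

primrec partial_conv :: "(nat \<Rightarrow> real measure) \<Rightarrow> nat \<Rightarrow> real measure" where
  "partial_conv m 0 = m 0"
| "partial_conv m (Suc n) = (partial_conv m n \<star> m (Suc n))"

definition is_infinite_convolution :: "(nat \<Rightarrow> real measure) \<Rightarrow> real measure \<Rightarrow> bool" where
  "is_infinite_convolution m M \<longleftrightarrow> real_distribution M \<and> converges_weakly (partial_conv m) M"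

text \<open>Unspecified if the infinite convolution does not exist.\<close>

definition infinite_convolution :: "(nat \<Rightarrow> real measure) \<Rightarrow> real measure" where
  "infinite_convolution m = (THE M. is_infinite_convolution m M)"

lemma infinite_convolution_eq:
  "is_infinite_convolution m M \<Longrightarrow> infinite_convolution m = M"
  unfolding infinite_convolution_def
  by (rule the_equality) (auto simp: is_infinite_convolution_def intro: converges_weakly_unique)

text \<open>With sequences indexed from 1, the factors of
  \<open>\<nu>\<^sub>>\<^sub>n = \<delta>(N\<^sub>n\<^sub>+\<^sub>1\<inverse> B\<^sub>n\<^sub>+\<^sub>1) \<star> \<delta>((N\<^sub>n\<^sub>+\<^sub>1 N\<^sub>n\<^sub>+\<^sub>2)\<inverse> B\<^sub>n\<^sub>+\<^sub>2) \<star> \<dots>\<close>; \<open>j = 0\<close> is the first one. For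
  \<open>n = 0\<close> these are the factors of \<open>\<mu>\<close>.\<close>

definition tail_factor :: "(nat \<Rightarrow> int) \<Rightarrow> (nat \<Rightarrow> int set) \<Rightarrow> nat \<Rightarrow> nat \<Rightarrow> real measure" where
  "tail_factor N B n j =
     unif_dirac ((\<lambda>b. inverse (real_of_int (\<Prod>i\<in>{n+1..n+1+j}. N i)) * real_of_int b) ` B (n+1+j))"

section \<open>Masks, Fourier transforms and integral periodic zeros\<close>

definition mask_poly :: "int set \<Rightarrow> real \<Rightarrow> complex" where
  "mask_poly B \<xi> = (1 / of_nat (card B)) * (\<Sum>b\<in>B. iexp (- 2 * pi * real_of_int b * \<xi>))"

definition zeros :: "(real \<Rightarrow> complex) \<Rightarrow> real set" where
  "zeros f = {x. f x = 0}"

definition discrete_set :: "real set \<Rightarrow> bool" where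
  "discrete_set A \<longleftrightarrow> (\<forall>x. \<not> x islimpt A)"

lemma discrete_set_iff: "discrete_set A \<longleftrightarrow> (\<forall>h>0. finite ({-h..h} \<inter> A))"
proof
  assume A: "discrete_set A"
  show "\<forall>h>0. finite ({-h..h} \<inter> A)"
  proof (intro allI impI)
    fix h :: real
    have "\<not> x islimpt ({-h..h} \<inter> A)" for x
      using A islimpt_subset[of x "{-h..h} \<inter> A" A] by (auto simp: discrete_set_def)
    then show "finite ({-h..h} \<inter> A)"
      using compact_Icc[of "-h" h] unfolding compact_eq_Bolzano_Weierstrass by blast
  qed
next
  assume A: "\<forall>h>0. finite ({-h..h} \<inter> A)"
  show "discrete_set A"
    unfolding discrete_set_def
  proof (intro allI notI)
    fix x assume x: "x islimpt A"
    have "infinite (A \<inter> ball x 1)"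
      using x by (auto simp: islimpt_eq_infinite_ball)
    moreover have "A \<inter> ball x 1 \<subseteq> {-(\<bar>x\<bar>+1)..\<bar>x\<bar>+1} \<inter> A"
      by (auto simp: dist_real_def)
    moreover have "finite ({-(\<bar>x\<bar>+1)..\<bar>x\<bar>+1} \<inter> A)"
      using A[rule_format, of "\<bar>x\<bar>+1"] by linarith
    ultimately show False
      using finite_subset by blast
  qed
qed

definition fourier :: "real measure \<Rightarrow> real \<Rightarrow> complex" where
  "fourier M \<xi> = (CLINT x|M. iexp (- 2 * pi * \<xi> * x))"

definition integral_periodic_zeros :: "real measure \<Rightarrow> real set" where
  "integral_periodic_zeros M = {\<xi>. \<forall>k :: int. fourier M (\<xi> + real_of_int k) = 0}"

end

theory Submission
  imports Defs
begin

text \<open>Write \<open>F n\<close> for the Fourier transform of \<open>\<nu>\<^sub>>\<^sub>n\<close> (with \<open>\<nu>\<^sub>>\<^sub>0 = \<mu>\<close>); then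
  \<open>F n \<xi> = M(\<xi>/N\<^sub>n\<^sub>+\<^sub>1) F (n+1) (\<xi>/N\<^sub>n\<^sub>+\<^sub>1)\<close> with \<open>M\<close> the mask of \<open>B\<^sub>n\<^sub>+\<^sub>1\<close>. The weakly convergent
  subsequence bounds the \<open>F n\<^sub>j\<close> away from 0 near the origin, so every zero of every \<open>F n\<close> comes from a
  mask and is an integer multiple of a point of the discrete set \<open>\<Union>\<^sub>k N\<^sub>k O(M\<^sub>B\<^sub>k)\<close>. Hence the sets \<open>X\<^sub>n\<close> of
  integral periodic zeros of \<open>\<nu>\<^sub>>\<^sub>n\<close> in \<open>[0,1)\<close> lie in one finite set. For \<open>\<xi> \<in> X\<^sub>n\<close> and every integer \<open>l\<close>
  with \<open>M((\<xi>+l)/N\<^sub>n\<^sub>+\<^sub>1) \<noteq> 0\<close>, the point \<open>(\<xi>+l)/N\<^sub>n\<^sub>+\<^sub>1\<close> is modulo 1 in \<open>X\<^sub>n\<^sub>+\<^sub>1\<close>, and distinct \<open>\<xi>\<close> or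
  distinct residues of \<open>l\<close> give distinct points. The cardinality of \<open>X\<^sub>n\<close> is therefore eventually
  constant, and from then on only one residue of \<open>l\<close> contributes. Completeness of the spectrum then
  forces all phases \<open>b (\<xi>+l)/N\<^sub>n\<^sub>+\<^sub>1\<close>, \<open>b \<in> B\<^sub>n\<^sub>+\<^sub>1\<close>, to agree modulo 1. Consequently, for such \<open>n\<close>,
  \<open>\<xi> \<in> X\<^sub>n\<close> is annihilated modulo 1 by all \<open>B\<^sub>j - B\<^sub>j\<close> with \<open>j > n\<close>, so \<open>\<xi>\<close> is an integer by the gcd
  condition, contradicting \<open>F n 0 = 1\<close>.\<close>

section \<open>Fourier transforms and tightness\<close>

lemma char_convolution:
  assumes "real_distribution M" "real_distribution N"
  shows "char (M \<star> N) t = char M t * char N t"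
proof -
  interpret M: real_distribution M by fact
  interpret N: real_distribution N by fact
  interpret P: pair_prob_space M N ..
  have int: "integrable (M \<Otimes>\<^sub>M N) (\<lambda>z. iexp (t * (fst z + snd z)))"
    by (rule P.integrable_const_bound[where B = 1]) (auto simp: norm_exp_i_times simp del: of_real_mult of_real_add)
  have "char (M \<star> N) t = (CLINT z|M \<Otimes>\<^sub>M N. iexp (t * (fst z + snd z)))"
    unfolding char_def convolution_def by (subst integral_distr) (auto simp: case_prod_beta)
  also have "\<dots> = (CLINT x|M. CLINT y|N. iexp (t * (x + y)))"
    using P.integral_fst'[OF int] by simp
  also have "\<dots> = (CLINT x|M. CLINT y|N. iexp (t * x) * iexp (t * y))"
    by (simp add: ring_distribs exp_add)
  also have "\<dots> = char M t * char N t"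
    by (simp add: char_def)
  finally show ?thesis .
qed

lemma real_distribution_convolution:
  assumes "real_distribution M" "real_distribution N"
  shows "real_distribution (M \<star> N)"
proof -
  interpret M: real_distribution M by fact
  interpret N: real_distribution N by fact
  interpret P: pair_prob_space M N ..
  show ?thesis
    unfolding convolution_def by (rule P.real_distribution_distr) simp
qed

lemma real_distribution_partial_conv:
  "(\<And>j. real_distribution (m j)) \<Longrightarrow> real_distribution (partial_conv m n)"
  by (induction n) (auto intro: real_distribution_convolution)

lemma char_partial_conv:
  "(\<And>j. real_distribution (m j)) \<Longrightarrow> char (partial_conv m n) t = (\<Prod>j\<le>n. char (m j) t)"
  by (induction n) (simp_all add: char_convolution real_distribution_partial_conv)

lemma fourier_eq_char: "fourier M \<xi> = char M (- 2 * pi * \<xi>)"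
  by (simp add: fourier_def char_def mult.assoc)

lemma isCont_fourier:
  assumes "real_distribution M"
  shows "isCont (fourier M) \<xi>"
proof -
  have "isCont (\<lambda>\<xi>. char M (- 2 * pi * \<xi>)) \<xi>"
    by (rule isCont_o2[OF _ real_distribution.isCont_char[OF assms]]) (intro continuous_intros)
  then show ?thesis
    by (simp add: fourier_eq_char[abs_def])
qed

lemma real_distribution_eqI:
  assumes "real_distribution M" "real_distribution N" "\<And>\<xi>. fourier M \<xi> = fourier N \<xi>"
  shows "M = N"
proof (rule Levy_uniqueness[OF assms(1,2)], rule ext)
  show "char M t = char N t" for t
    using assms(3)[of "- t / (2 * pi)"] by (simp add: fourier_eq_char)
qed

lemma fourier_tendsto:
  assumes "\<And>n. real_distribution (M n)" "real_distribution M'" "converges_weakly M M'"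
  shows "(\<lambda>n. fourier (M n) \<xi>) \<longlonglongrightarrow> fourier M' \<xi>"
  unfolding fourier_eq_char
  by (rule levy_continuity1[OF assms(1,2)]) (use assms converges_weakly_iff_weak_conv_m in blast)

text \<open>Partial convolutions grow on the right, while the passage from one tail to the next
  removes the leftmost factor. Comparing Fourier transforms reduces the regrouping to a shift of a
  finite product.\<close>

lemma partial_conv_Suc_left:
  assumes "\<And>j. real_distribution (m j)"
  shows "partial_conv m (Suc n) = (m 0 \<star> partial_conv (\<lambda>j. m (Suc j)) n)"
proof (rule real_distribution_eqI)
  have tail: "real_distribution (partial_conv (\<lambda>j. m (Suc j)) n)"
    by (rule real_distribution_partial_conv) (rule assms)
  show "real_distribution (partial_conv m (Suc n))"
    by (rule real_distribution_partial_conv) (rule assms)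
  show "real_distribution (m 0 \<star> partial_conv (\<lambda>j. m (Suc j)) n)"
    by (rule real_distribution_convolution[OF assms tail])
  show "fourier (partial_conv m (Suc n)) \<xi> = fourier (m 0 \<star> partial_conv (\<lambda>j. m (Suc j)) n) \<xi>" for \<xi>
    unfolding fourier_eq_char char_convolution[OF assms tail] char_partial_conv[of m, OF assms]
      char_partial_conv[of "\<lambda>j. m (Suc j)", OF assms]
    by (rule prod.atMost_Suc_shift)
qed

section \<open>Tail bounds and tightness\<close>

lemma real_distribution_tail:
  assumes "real_distribution M" "\<epsilon> > 0"
  shows "\<exists>R>0. measure M {x. \<bar>x\<bar> > R} < \<epsilon>"
proof -
  interpret real_distribution M by fact
  have [simp]: "{x::real. \<bar>x\<bar> > real n} \<in> sets borel" for n
    by measurable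
  have "(\<lambda>n. measure M {x. \<bar>x\<bar> > real n}) \<longlonglongrightarrow> measure M (\<Inter>n. {x. \<bar>x\<bar> > real n})"
    by (rule finite_Lim_measure_decseq) (auto simp: decseq_def)
  moreover have "(\<Inter>n. {x::real. \<bar>x\<bar> > real n}) = {}"
    by (auto simp: not_less) (meson not_less_iff_gr_or_eq reals_Archimedean2)
  ultimately have "(\<lambda>n. measure M {x. \<bar>x\<bar> > real n}) \<longlonglongrightarrow> 0"
    by simp
  then have "\<forall>\<^sub>F n in sequentially. measure M {x. \<bar>x\<bar> > real n} < \<epsilon>"
    using assms(2) by (rule order_tendstoD)
  then have "\<forall>\<^sub>F n in sequentially. n > 0 \<and> measure M {x. \<bar>x\<bar> > real n} < \<epsilon>"
    using eventually_gt_at_top[of 0] by eventually_elim auto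
  then obtain n where "n > 0" "measure M {x. \<bar>x\<bar> > real n} < \<epsilon>"
    using eventually_happens'[OF sequentially_bot] by blast
  then show ?thesis
    by (intro exI[of _ "real n"]) auto
qed

text \<open>Bounds for all large \<open>n\<close> suffice: each of the finitely many remaining
  measures has small tails of its own, and a maximum of radii serves them all.\<close>

lemma tightI:
  assumes M: "\<And>n. real_distribution (M n)"
    and ev: "\<And>\<epsilon>. \<epsilon> > 0 \<Longrightarrow> \<exists>R. \<forall>\<^sub>F n in sequentially. measure (M n) {x. \<bar>x\<bar> > R} < \<epsilon>"
  shows "tight M"
  unfolding tight_def
proof (intro conjI allI impI)
  fix \<epsilon> :: real assume "\<epsilon> > 0"
  obtain R n0 where R: "\<And>n. n \<ge> n0 \<Longrightarrow> measure (M n) {x. \<bar>x\<bar> > R} < \<epsilon>"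
    using ev[OF \<open>\<epsilon> > 0\<close>] by (auto simp: eventually_sequentially)
  obtain S where S: "\<And>n. S n > 0" "\<And>n. measure (M n) {x. \<bar>x\<bar> > S n} < \<epsilon>"
    using real_distribution_tail[OF M \<open>\<epsilon> > 0\<close>] by metis
  define T where "T = Max (insert (max R 1) (S ` {..<n0}))"
  have "T \<ge> max R 1" "\<And>n. n < n0 \<Longrightarrow> T \<ge> S n"
    unfolding T_def by (rule Max_ge; force)+
  then have T: "T \<ge> 1" "T \<ge> R" "\<And>n. n < n0 \<Longrightarrow> T \<ge> S n"
    by auto
  show "\<exists>a b. a < b \<and> (\<forall>n. measure (M n) {a<..b} > 1 - \<epsilon>)"
  proof (intro exI conjI allI)
    \<comment> \<open>The interval excludes its left end, so this end is moved beyond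
      \<open>-T\<close>; points outside the interval then satisfy \<bar>x\<bar> > T
      strictly.\<close>
    show "- T - 1 < T" using T by simp
    fix n
    interpret real_distribution "M n" by (rule M)
    have [simp]: "{x::real. \<bar>x\<bar> > r} \<in> sets borel" for r
      by measurable
    have "measure (M n) {x. \<bar>x\<bar> > T} < \<epsilon>"
    proof (cases "n < n0")
      case True
      have "measure (M n) {x. \<bar>x\<bar> > T} \<le> measure (M n) {x. \<bar>x\<bar> > S n}"
        using T(3)[OF True] by (intro finite_measure_mono) auto
      then show ?thesis using S(2)[of n] by simp
    next
      case False
      have "measure (M n) {x. \<bar>x\<bar> > T} \<le> measure (M n) {x. \<bar>x\<bar> > R}"
        using T(2) by (intro finite_measure_mono) auto
      then show ?thesis using R[of n] False by simp
    qed
    moreover have "1 - measure (M n) {-T-1<..T} = measure (M n) (space (M n) - {-T-1<..T})"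
      by (subst prob_compl) auto
    moreover have "\<dots> \<le> measure (M n) {x. \<bar>x\<bar> > T}"
      by (intro finite_measure_mono) auto
    ultimately show "measure (M n) {-T-1<..T} > 1 - \<epsilon>"
      by simp
  qed
qed (rule M)

lemma tight_tail:
  assumes "tight M" "\<epsilon> > 0"
  shows "\<exists>R>0. \<forall>n. measure (M n) {x. \<bar>x\<bar> > R} < \<epsilon>"
proof -
  obtain a b where ab: "\<And>n. measure (M n) {a<..b} > 1 - \<epsilon>"
    using assms unfolding tight_def by blast
  show ?thesis
  proof (intro exI[of _ "max (max \<bar>a\<bar> \<bar>b\<bar>) 1"] conjI allI)
    fix n
    interpret real_distribution "M n" using assms by (simp add: tight_def)
    have "measure (M n) {x. \<bar>x\<bar> > max (max \<bar>a\<bar> \<bar>b\<bar>) 1} \<le> measure (M n) (space (M n) - {a<..b})"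
      by (intro finite_measure_mono) auto
    also have "\<dots> = 1 - measure (M n) {a<..b}"
      by (subst prob_compl) auto
    finally show "measure (M n) {x. \<bar>x\<bar> > max (max \<bar>a\<bar> \<bar>b\<bar>) 1} < \<epsilon>"
      using ab[of n] by simp
  qed auto
qed

lemma converges_weakly_imp_tight:
  assumes M: "\<And>n. real_distribution (M n)" and M': "real_distribution M'"
    and conv: "converges_weakly M M'"
  shows "tight M"
proof (rule tightI[OF M])
  fix \<epsilon> :: real assume "\<epsilon> > 0"
  interpret M': real_distribution M' by fact
  interpret M: real_distribution "M n" for n by (rule M)
  have [measurable]: "{x::real. \<bar>x\<bar> > r} \<in> sets borel" for r
    by measurable
  obtain R where R: "R > 0" "measure M' {x. \<bar>x\<bar> > R} < \<epsilon>"
    using real_distribution_tail[OF M' \<open>\<epsilon> > 0\<close>] by blast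
  \<comment> \<open>A continuous cut-off between the indicators of \<bar>x\<bar> > R + 1 and
    \<bar>x\<bar> > R: the lower one bounds the tails of \<open>M n\<close>, the upper one the
    integral against the limit.\<close>
  define f :: "real \<Rightarrow> real" where "f x = max 0 (min 1 (\<bar>x\<bar> - R))" for x
  have f: "continuous_on UNIV f" "bounded (range f)" "\<And>x. \<bar>f x\<bar> \<le> 1"
    by (auto simp: f_def bounded_iff intro!: continuous_intros exI[of _ 1])
  have [measurable]: "f \<in> borel_measurable borel"
    using f(1) by (rule borel_measurable_continuous_onI)
  have int: "integrable (M n) f" "integrable M' f" for n
    using f(3) by (auto intro!: M.integrable_const_bound[where B = 1] M'.integrable_const_bound[where B = 1])
  have "(\<lambda>n. integral\<^sup>L (M n) f) \<longlonglongrightarrow> integral\<^sup>L M' f"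
    using conv f by (simp add: converges_weakly_def)
  moreover have "integral\<^sup>L M' f \<le> integral\<^sup>L M' (indicator {x. \<bar>x\<bar> > R})"
    using int by (intro integral_mono) (auto simp: f_def indicator_def M'.emeasure_eq_measure)
  then have "integral\<^sup>L M' f < \<epsilon>"
    using R by simp
  ultimately have "\<forall>\<^sub>F n in sequentially. integral\<^sup>L (M n) f < \<epsilon>"
    by (rule order_tendstoD)
  moreover have "measure (M n) {x. \<bar>x\<bar> > R + 1} \<le> integral\<^sup>L (M n) f" for n
  proof -
    have "measure (M n) {x. \<bar>x\<bar> > R + 1} = integral\<^sup>L (M n) (indicator {x. \<bar>x\<bar> > R + 1})"
      by simp
    also have "\<dots> \<le> integral\<^sup>L (M n) f"
      using int by (intro integral_mono) (auto simp: f_def indicator_def M.emeasure_eq_measure)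
    finally show ?thesis .
  qed
  ultimately show "\<exists>R. \<forall>\<^sub>F n in sequentially. measure (M n) {x. \<bar>x\<bar> > R} < \<epsilon>"
    by (intro exI[of _ "R + 1"]) (auto elim!: eventually_mono intro: le_less_trans)
qed

text \<open>If \<open>A\<close> gives [-K, K] mass above 1/2, then \<bar>x\<bar> > R + K and
  \<bar>a\<bar> \<le> K force \<bar>a + x\<bar> > R. Hence the tail of \<open>S n\<close> is at most
  twice that of the convolution.\<close>

lemma tight_convolution_factor:
  assumes A: "real_distribution A" and S: "\<And>n. real_distribution (S n)"
    and tight: "tight (\<lambda>n. A \<star> S n)"
  shows "tight S"
proof (rule tightI[OF S])
  fix \<epsilon> :: real assume "\<epsilon> > 0"
  interpret A: real_distribution A by fact
  interpret S: real_distribution "S n" for n by (rule S)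
  interpret P: real_distribution "A \<star> S n" for n
    by (rule real_distribution_convolution[OF A S])
  have [measurable]: "{x::real. \<bar>x\<bar> > r} \<in> sets borel" for r
    by measurable
  obtain K where K: "K > 0" "measure A {x. \<bar>x\<bar> > K} < 1 / 2"
    using real_distribution_tail[OF A, of "1 / 2"] by auto
  obtain R where R: "R > 0" "\<And>n. measure (A \<star> S n) {x. \<bar>x\<bar> > R} < \<epsilon> / 2"
    using tight_tail[OF tight, of "\<epsilon> / 2"] \<open>\<epsilon> > 0\<close> by auto
  have "measure A (space A - {x. \<bar>x\<bar> > K}) = 1 - measure A {x. \<bar>x\<bar> > K}"
    by (rule A.prob_compl) simp
  then have K': "measure A (- {x. \<bar>x\<bar> > K}) > 1 / 2"
    using K by (simp add: Compl_eq_Diff_UNIV)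
  have "measure (S n) {x. \<bar>x\<bar> > R + K} < \<epsilon>" for n
  proof -
    have "emeasure (S n) {x. \<bar>x\<bar> > R + K} * emeasure A (- {x. \<bar>x\<bar> > K})
        = (\<integral>\<^sup>+x. emeasure (S n) {x. \<bar>x\<bar> > R + K} * indicator (- {x. \<bar>x\<bar> > K}) x \<partial>A)"
      by (subst nn_integral_cmult_indicator) auto
    also have "\<dots> \<le> (\<integral>\<^sup>+x. emeasure (S n) {a. a + x \<in> {x. \<bar>x\<bar> > R}} \<partial>A)"
      by (intro nn_integral_mono) (auto simp: indicator_def intro!: emeasure_mono)
    also have "\<dots> = emeasure (A \<star> S n) {x. \<bar>x\<bar> > R}"
      by (subst convolution_emeasure) (auto simp: A.finite_measure_axioms S.finite_measure_axioms)
    finally have "measure (S n) {x. \<bar>x\<bar> > R + K} * measure A (- {x. \<bar>x\<bar> > K})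
        \<le> measure (A \<star> S n) {x. \<bar>x\<bar> > R}"
      unfolding A.emeasure_eq_measure S.emeasure_eq_measure P.emeasure_eq_measure
      by (simp flip: ennreal_mult)
    moreover have "measure (S n) {x. \<bar>x\<bar> > R + K} * (1 / 2)
        \<le> measure (S n) {x. \<bar>x\<bar> > R + K} * measure A (- {x. \<bar>x\<bar> > K})"
      using K' by (intro mult_left_mono) auto
    ultimately show ?thesis
      using R(2)[of n] by simp
  qed
  then show "\<exists>R. \<forall>\<^sub>F n in sequentially. measure (S n) {x. \<bar>x\<bar> > R} < \<epsilon>"
    by (intro exI[of _ "R + K"]) simp
qed

text \<open>The two functions agree on a punctured neighbourhood of \<open>x\<close>, so their
  limits at \<open>x\<close> coincide.\<close>

lemma isCont_eqI_discrete:
  fixes f g :: "real \<Rightarrow> complex"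
  assumes "isCont f x" "isCont g x" "discrete_set D" "\<And>y. y \<notin> D \<Longrightarrow> f y = g y"
  shows "f x = g x"
proof -
  have "\<forall>\<^sub>F y in at x. y \<notin> D"
    using assms(3) by (simp add: discrete_set_def islimpt_iff_eventually)
  then have "\<forall>\<^sub>F y in at x. f y = g y"
    by eventually_elim (rule assms(4))
  then have "(f \<longlongrightarrow> g x) (at x)"
    using assms(2) by (simp add: isCont_def tendsto_cong)
  then show ?thesis
    using assms(1) unfolding isCont_def by (intro tendsto_unique[OF at_neq_bot])
qed

text \<open>By continuity, a subsequential limit of \<open>S\<close> is determined by its Fourier transform off the zeros
  of that of \<open>A\<close>, where it is a quotient.\<close>

lemma converges_weakly_deconvolution:
  assumes A: "real_distribution A" and S: "\<And>n. real_distribution (S n)"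
    and P: "real_distribution P" and conv: "converges_weakly (\<lambda>n. A \<star> S n) P"
    and disc: "discrete_set (zeros (fourier A))"
  shows "\<exists>T. real_distribution T \<and> converges_weakly S T"
proof -
  have AS: "real_distribution (A \<star> S n)" for n
    by (rule real_distribution_convolution[OF A S])
  have tight: "tight S"
    by (rule tight_convolution_factor[OF A S converges_weakly_imp_tight[OF AS P conv]])
  have limit: "fourier A \<xi> * fourier T \<xi> = fourier P \<xi>"
    if "strict_mono s" "real_distribution T" "weak_conv_m (S \<circ> s) T" for s T \<xi>
  proof (rule LIMSEQ_unique)
    have "(\<lambda>n. fourier (S (s n)) \<xi>) \<longlonglongrightarrow> fourier T \<xi>"
      using levy_continuity1[OF _ that(2,3)] S by (simp add: fourier_eq_char)
    then show "(\<lambda>n. fourier A \<xi> * fourier (S (s n)) \<xi>) \<longlonglongrightarrow> fourier A \<xi> * fourier T \<xi>"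
      by (rule tendsto_mult_left)
    show "(\<lambda>n. fourier A \<xi> * fourier (S (s n)) \<xi>) \<longlonglongrightarrow> fourier P \<xi>"
      using LIMSEQ_subseq_LIMSEQ[OF fourier_tendsto[OF AS P conv] that(1)] A S
      by (simp add: o_def fourier_eq_char char_convolution)
  qed
  obtain r T where r: "strict_mono r" and T: "real_distribution T" and rT: "weak_conv_m (S \<circ> r) T"
    using tight_imp_convergent_subsubsequence[OF tight strict_mono_id] by auto
  \<comment> \<open>A tight sequence converges as soon as all its weak subsequential limits are the
    same measure; each is compared with the one limit \<open>T\<close> already extracted.\<close>
  have "weak_conv_m S T"
  proof (rule tight_subseq_weak_converge[OF S T tight])
    fix s T' assume s: "strict_mono s" and T': "real_distribution T'" and w: "weak_conv_m (S \<circ> s) T'"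
    have "fourier T' \<xi> = fourier T \<xi>" for \<xi>
    proof (rule isCont_eqI_discrete[OF _ _ disc])
      show "fourier T' y = fourier T y" if "y \<notin> zeros (fourier A)" for y
        using that limit[OF s T' w, of y] limit[OF r T rT, of y]
        by (metis (mono_tags) mem_Collect_eq mult_left_cancel zeros_def)
    qed (simp_all add: isCont_fourier T T')
    then have "T' = T"
      by (rule real_distribution_eqI[OF T' T])
    with w show "weak_conv_m (S \<circ> s) T" by simp
  qed
  then show ?thesis
    using S T by (auto simp: converges_weakly_iff_weak_conv_m)
qed

section \<open>Dilations of measures\<close>

lemma fourier_distr_mult:
  assumes "real_distribution M"
  shows "fourier (distr M borel (\<lambda>x. c * x)) \<xi> = fourier M (c * \<xi>)"
proof -
  interpret real_distribution M by fact
  show ?thesis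
    unfolding fourier_def by (subst integral_distr) (auto simp: ac_simps)
qed

lemma real_distribution_distr_mult:
  assumes "real_distribution M"
  shows "real_distribution (distr M borel (\<lambda>x. c * x))"
proof -
  interpret real_distribution M by fact
  show ?thesis by (rule real_distribution_distr) simp
qed

lemma converges_weakly_distr_mult:
  assumes M: "\<And>n. real_distribution (M n)" "real_distribution M'" and conv: "converges_weakly M M'"
  shows "converges_weakly (\<lambda>n. distr (M n) borel (\<lambda>x. c * x)) (distr M' borel (\<lambda>x. c * x))"
  unfolding converges_weakly_def
proof (intro allI impI)
  fix f :: "real \<Rightarrow> real" assume f: "continuous_on UNIV f \<and> bounded (range f)"
  interpret M: real_distribution "M n" for n by (rule M)
  interpret M': real_distribution M' by (rule M)
  have meas: "(\<lambda>x. c * x) \<in> measurable (M n) borel" "(\<lambda>x. c * x) \<in> measurable M' borel" for n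
    by simp_all
  have "f \<in> borel_measurable borel"
    using f by (intro borel_measurable_continuous_onI) simp
  moreover have "bounded (range (\<lambda>x. f (c * x)))"
    by (rule bounded_subset[of "range f"]) (use f in auto)
  moreover have "continuous_on UNIV (\<lambda>x. f (c * x))"
    by (rule continuous_on_compose2[of UNIV f]) (use f in \<open>auto intro: continuous_intros\<close>)
  ultimately have "f \<in> borel_measurable borel"
    and "(\<lambda>n. integral\<^sup>L (M n) (\<lambda>x. f (c * x))) \<longlonglongrightarrow> integral\<^sup>L M' (\<lambda>x. f (c * x))"
    using conv unfolding converges_weakly_def by blast+
  then show "(\<lambda>n. integral\<^sup>L (distr (M n) borel (\<lambda>x. c * x)) f)
      \<longlonglongrightarrow> integral\<^sup>L (distr M' borel (\<lambda>x. c * x)) f"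
    using meas by (simp add: integral_distr)
qed

text \<open>Tightness makes the Fourier transforms equicontinuous at the origin, where they equal 1.\<close>

lemma tight_fourier_nonzero:
  assumes "tight M"
  shows "\<exists>\<delta>>0. \<forall>n \<xi>. \<bar>\<xi>\<bar> < \<delta> \<longrightarrow> fourier (M n) \<xi> \<noteq> 0"
proof -
  obtain R where R: "R > 0" "\<And>n. measure (M n) {x. \<bar>x\<bar> > R} < 1 / 4"
    using tight_tail[OF assms, of "1 / 4"] by auto
  \<comment> \<open>Chosen so that the phase 2 pi \<bar>\<xi>\<bar> \<bar>x\<bar> is at most 1/2 on
    [-R, R]. The rest has mass below 1/4, where the trivial bound 2 is used, so the transform
    differs from 1 by less than 1.\<close>
  define \<delta> where "\<delta> = 1 / (4 * pi * R)"
  have "fourier (M n) \<xi> \<noteq> 0" if \<xi>: "\<bar>\<xi>\<bar> < \<delta>" for n \<xi>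
  proof
    assume zero: "fourier (M n) \<xi> = 0"
    interpret real_distribution "M n" using assms by (simp add: tight_def)
    have [measurable]: "{x::real. \<bar>x\<bar> > R} \<in> sets borel"
      by measurable
    have int: "integrable (M n) (\<lambda>x. iexp (- 2 * pi * \<xi> * x))"
      by (rule integrable_const_bound[where B = 1]) (auto simp: norm_exp_i_times simp del: of_real_mult)
    have bound: "cmod (iexp (- 2 * pi * \<xi> * x) - 1) \<le> 1 / 2 + 2 * indicator {x. \<bar>x\<bar> > R} x" for x
    proof (cases "\<bar>x\<bar> > R")
      case True
      have "cmod (iexp (- 2 * pi * \<xi> * x) - 1) \<le> cmod (iexp (- 2 * pi * \<xi> * x)) + cmod 1"
        by (rule norm_triangle_ineq4)
      then show ?thesis
        using True by (simp only: norm_exp_i_times) simp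
    next
      case False
      have "cmod (iexp (- 2 * pi * \<xi> * x) - 1) \<le> \<bar>- 2 * pi * \<xi> * x\<bar>"
        using iexp_approx1[of "- 2 * pi * \<xi> * x" 0] by simp
      also have "\<dots> = 2 * pi * (\<bar>\<xi>\<bar> * \<bar>x\<bar>)"
        by (simp add: abs_mult)
      also have "\<dots> \<le> 2 * pi * (\<delta> * R)"
        using False \<xi> by (intro mult_left_mono mult_mono) auto
      also have "\<dots> = 1 / 2"
        using R(1) by (simp add: \<delta>_def field_simps)
      finally show ?thesis using False by simp
    qed
    have "1 = cmod (fourier (M n) \<xi> - 1)"
      using zero by simp
    also have "fourier (M n) \<xi> - 1 = (CLINT x|M n. iexp (- 2 * pi * \<xi> * x) - 1)"
      unfolding fourier_def using int prob_space by (subst Bochner_Integration.integral_diff) auto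
    also have "cmod \<dots> \<le> (LINT x|M n. 1 / 2 + 2 * indicator {x. \<bar>x\<bar> > R} x)"
      using int by (intro Bochner_Integration.integral_norm_bound_integral bound
        Bochner_Integration.integrable_add Bochner_Integration.integrable_diff
        integrable_mult_right integrable_real_indicator) (auto simp: emeasure_eq_measure)
    also have "\<dots> = 1 / 2 + 2 * measure (M n) {x. \<bar>x\<bar> > R}"
      using prob_space by (subst Bochner_Integration.integral_add)
        (auto intro!: integrable_real_indicator simp: emeasure_eq_measure)
    also have "\<dots> < 1" using R(2)[of n] by simp
    finally show False by simp
  qed
  then show ?thesis
    using R(1) by (intro exI[of _ \<delta>]) (auto simp: \<delta>_def)
qed

section \<open>Spectra of uniform measures\<close>

lemma integral_unif_dirac:
  fixes f :: "real \<Rightarrow> 'b::{banach, second_countable_topology}"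
  assumes "finite A" "A \<noteq> {}" "f \<in> borel_measurable borel"
  shows "integral\<^sup>L (unif_dirac A) f = (\<Sum>x\<in>A. f x) /\<^sub>R real (card A)"
proof -
  have "integral\<^sup>L (unif_dirac A) f = integral\<^sup>L (measure_pmf (pmf_of_set A)) f"
    unfolding unif_dirac_def using assms(3) by (subst integral_distr) auto
  also have "\<dots> = (\<Sum>x\<in>A. pmf (pmf_of_set A) x *\<^sub>R f x)"
    using assms by (intro integral_measure_pmf) (auto simp: set_pmf_of_set)
  also have "\<dots> = (\<Sum>x\<in>A. f x) /\<^sub>R real (card A)"
    using assms by (simp add: indicator_def scaleR_sum_right divide_inverse)
  finally show ?thesis .
qed

lemma spectrum_orthogonal:
  assumes "finite A" "A \<noteq> {}" "is_spectrum (unif_dirac A) \<Lambda>" "l \<in> \<Lambda>" "l' \<in> \<Lambda>" "l \<noteq> l'"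
  shows "(\<Sum>x\<in>A. iexp (2 * pi * l * x) * cnj (iexp (2 * pi * l' * x))) = 0"
proof -
  have "(CLINT x|unif_dirac A. iexp (2 * pi * l * x) * cnj (iexp (2 * pi * l' * x))) = 0"
    using assms(3-6) unfolding is_spectrum_def by meson
  moreover have "(\<lambda>x. iexp (2 * pi * l * x) * cnj (iexp (2 * pi * l' * x))) \<in> borel_measurable borel"
    by (intro borel_measurable_continuous_onI continuous_intros)
  ultimately show ?thesis
    using assms(1,2) by (simp add: integral_unif_dirac)
qed

text \<open>If \<open>g\<close> is orthogonal to the span, then by Pythagoras no element of the span
  is closer to \<open>g\<close> than 0 is, so density makes the norm of \<open>g\<close> vanish.
  Every point of \<open>A\<close> has positive mass, which gives pointwise vanishing.\<close>

lemma spectrum_total: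
  assumes A: "finite A" "A \<noteq> {}" and spec: "is_spectrum (unif_dirac A) \<Lambda>"
    and g: "g \<in> borel_measurable borel"
    and orth: "\<And>l. l \<in> \<Lambda> \<Longrightarrow> (\<Sum>x\<in>A. g x * cnj (iexp (2 * pi * l * x))) = 0"
    and x: "x \<in> A"
  shows "g x = 0"
proof -
  define S where "S = (\<Sum>x\<in>A. (cmod (g x))\<^sup>2)"
  have "square_integrable (unif_dirac A) g"
    unfolding square_integrable_def
  proof
    show "g \<in> borel_measurable (unif_dirac A)"
      using g by (simp add: unif_dirac_def)
    have "integrable (measure_pmf (pmf_of_set A)) (\<lambda>x. (cmod (g x))\<^sup>2)"
      using A by (intro integrable_measure_pmf_finite) simp
    then show "integrable (unif_dirac A) (\<lambda>x. (cmod (g x))\<^sup>2)"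
      unfolding unif_dirac_def using g by (subst integrable_distr_eq) auto
  qed
  then have *: "\<exists>F c. finite F \<and> F \<subseteq> \<Lambda> \<and>
      (LINT x|unif_dirac A. (cmod (g x - (\<Sum>l\<in>F. c l * iexp (2 * pi * l * x))))\<^sup>2) < \<epsilon>"
    if "\<epsilon> > 0" for \<epsilon>
    using spec that unfolding is_spectrum_def by blast
  have "S / card A \<le> \<epsilon>" if \<epsilon>: "\<epsilon> > 0" for \<epsilon>
  proof -
    obtain F c where F: "finite F" "F \<subseteq> \<Lambda>"
      and small: "(LINT x|unif_dirac A. (cmod (g x - (\<Sum>l\<in>F. c l * iexp (2 * pi * l * x))))\<^sup>2) < \<epsilon>"
      using *[OF \<epsilon>] by blast
    define s where "s x = (\<Sum>l\<in>F. c l * iexp (2 * pi * l * x))" for x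
    have s: "s \<in> borel_measurable borel"
      unfolding s_def by (intro borel_measurable_continuous_onI continuous_intros)
    have "(\<Sum>x\<in>A. g x * cnj (s x)) = (\<Sum>l\<in>F. cnj (c l) * (\<Sum>x\<in>A. g x * cnj (iexp (2 * pi * l * x))))"
      unfolding s_def cnj_sum sum_distrib_left
      by (subst sum.swap) (simp add: ac_simps)
    also have "\<dots> = 0"
      using F(2) orth by (intro sum.neutral ballI) (metis mult_zero_right subsetD)
    finally have "Re (\<Sum>x\<in>A. g x * cnj (s x)) = 0"
      by simp
    then have gs: "(\<Sum>x\<in>A. Re (g x * cnj (s x))) = 0"
      by (simp only: Re_sum)
    \<comment> \<open>The cross terms sum to 0 by \<open>gs\<close>, and the squares of
      \<open>s\<close> only add.\<close>
    have "S \<le> (\<Sum>x\<in>A. (cmod (g x))\<^sup>2 + (cmod (s x))\<^sup>2 - 2 * Re (g x * cnj (s x)))"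
      unfolding S_def sum.distrib sum_subtractf sum_distrib_left[symmetric] gs by (simp add: sum_nonneg)
    also have "\<dots> = (\<Sum>x\<in>A. (cmod (g x - s x))\<^sup>2)"
      unfolding cmod_power2 by (intro sum.cong) (simp_all add: power2_eq_square algebra_simps)
    also have "\<dots> = (LINT x|unif_dirac A. (cmod (g x - s x))\<^sup>2) * card A"
      using A g s by (subst integral_unif_dirac) auto
    also have "\<dots> \<le> \<epsilon> * card A"
      using small by (intro mult_right_mono) (auto simp: s_def)
    finally show ?thesis
      using A by (simp add: divide_le_eq card_gt_0_iff)
  qed
  then have "S / card A \<le> 0"
    by (rule field_le_epsilon[of _ 0, simplified])
  moreover have "S \<ge> 0"
    by (simp add: S_def sum_nonneg)
  ultimately have "S = 0"
    using A by (simp add: divide_le_0_iff card_gt_0_iff)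
  then show ?thesis
    using A(1) x by (simp add: S_def sum_nonneg_eq_0_iff)
qed

section \<open>Exponentials and mask polynomials\<close>

lemma iexp_eq_1_iff: "iexp (2 * pi * x) = 1 \<longleftrightarrow> x \<in> \<int>"
proof -
  have "iexp (2 * pi * x) = 1 \<longleftrightarrow> (\<exists>n::int. x = of_int n)"
    by (simp add: exp_eq_1 mult.commute[of pi])
  then show ?thesis by (auto elim: Ints_cases)
qed

lemma iexp_mult: "iexp x * iexp y = iexp (x + y)"
  by (simp add: distrib_left flip: exp_add)

lemma cnj_iexp: "cnj (iexp x) = iexp (- x)"
  by (simp add: exp_cnj)

lemma mask_poly_add_int: "mask_poly B (\<xi> + of_int k) = mask_poly B \<xi>"
proof -
  have "iexp (- 2 * pi * of_int b * (\<xi> + of_int k)) = iexp (- 2 * pi * of_int b * \<xi>)" for b :: int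
  proof -
    have "iexp (- 2 * pi * of_int b * (\<xi> + of_int k))
        = iexp (- 2 * pi * of_int b * \<xi>) * iexp (2 * pi * of_int (- b * k))"
      unfolding iexp_mult by (rule arg_cong[where f = iexp]) (simp add: algebra_simps)
    then show ?thesis
      by (subst (asm) iexp_eq_1_iff[THEN iffD2]) auto
  qed
  then show ?thesis
    unfolding mask_poly_def by simp
qed

lemma mask_poly_0: "finite B \<Longrightarrow> B \<noteq> {} \<Longrightarrow> mask_poly B 0 = 1"
  by (simp add: mask_poly_def)

lemma fourier_unif_dirac:
  assumes "finite B" "B \<noteq> {}" "c \<noteq> 0"
  shows "fourier (unif_dirac ((\<lambda>b. inverse (real_of_int c) * real_of_int b) ` B)) \<xi> = mask_poly B (\<xi> / c)"
proof -
  have inj: "inj_on (\<lambda>b. inverse (real_of_int c) * real_of_int b) B"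
    using assms(3) by (auto simp: inj_on_def)
  have "(\<lambda>x. iexp (- 2 * pi * \<xi> * x)) \<in> borel_measurable borel"
    by (intro borel_measurable_continuous_onI continuous_intros)
  moreover have "iexp (- 2 * pi * \<xi> * (inverse (real_of_int c) * real_of_int b))
      = iexp (- 2 * pi * real_of_int b * (\<xi> / c))" for b
    by (rule arg_cong[where f = iexp]) (simp add: divide_inverse)
  ultimately show ?thesis
    unfolding fourier_def mask_poly_def using assms(1,2)
    by (simp only: integral_unif_dirac finite_imageI image_is_empty not_False_eq_True card_image[OF inj] sum.reindex[OF inj] o_def
        scaleR_conv_of_real) (simp add: divide_inverse)
qed

text \<open>Up to the factor \<open>card B\<close>, the values of the mask are the coefficients of
  the exponential of frequency -\<xi> with respect to the integer exponentials. This translates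
  spectral statements into statements on zeros of the mask.\<close>

lemma sum_exp_eq_mask_poly:
  assumes "finite B" "B \<noteq> {}" "c \<noteq> 0"
  shows "(\<Sum>x\<in>(\<lambda>b. inverse (real_of_int c) * real_of_int b) ` B.
      iexp (- 2 * pi * \<xi> * x) * cnj (iexp (2 * pi * of_int l * x)))
    = of_nat (card B) * mask_poly B ((\<xi> + of_int l) / c)"
proof -
  have inj: "inj_on (\<lambda>b. inverse (real_of_int c) * real_of_int b) B"
    using assms(3) by (auto simp: inj_on_def)
  have "iexp (- 2 * pi * \<xi> * x) * cnj (iexp (2 * pi * of_int l * x)) = iexp (- 2 * pi * (\<xi> + of_int l) * x)" for x
    unfolding cnj_iexp iexp_mult by (rule arg_cong[where f = iexp]) (simp add: algebra_simps)
  moreover have "iexp (- 2 * pi * (\<xi> + of_int l) * (inverse (real_of_int c) * real_of_int b))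
      = iexp (- 2 * pi * real_of_int b * ((\<xi> + of_int l) / c))" for b
    by (rule arg_cong[where f = iexp]) (simp add: divide_inverse)
  ultimately show ?thesis
    unfolding mask_poly_def using assms(1,2) by (simp only: sum.reindex[OF inj] o_def) simp
qed

lemma admissible_pairD:
  assumes "admissible_pair N B"
  shows "\<bar>N\<bar> \<ge> 2" "N \<noteq> 0" "finite B" "B \<noteq> {}"
  using assms by (auto simp: admissible_pair_def)

text \<open>Otherwise the exponential of frequency -\<xi> would be orthogonal to the whole basis and
  hence vanish on the support.\<close>

lemma spectrum_mask_poly_nonzero:
  assumes B: "finite B" "B \<noteq> {}" and N: "N \<noteq> 0"
    and L: "is_spectrum (unif_dirac ((\<lambda>b. inverse (real_of_int N) * real_of_int b) ` B)) (real_of_int ` L)"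
  shows "\<exists>l\<in>L. mask_poly B ((\<xi> + of_int l) / N) \<noteq> 0"
proof (rule ccontr)
  assume zero: "\<not> ?thesis"
  obtain b where b: "b \<in> B" using B by blast
  have "iexp (- 2 * pi * \<xi> * (inverse (real_of_int N) * real_of_int b)) = 0"
  proof (rule spectrum_total[where g = "\<lambda>x. iexp (- 2 * pi * \<xi> * x)", OF _ _ L])
    show "(\<lambda>x. iexp (- 2 * pi * \<xi> * x)) \<in> borel_measurable borel"
      by (intro borel_measurable_continuous_onI continuous_intros)
    fix l assume "l \<in> real_of_int ` L"
    then show "(\<Sum>x\<in>(\<lambda>b. inverse (real_of_int N) * real_of_int b) ` B.
        iexp (- 2 * pi * \<xi> * x) * cnj (iexp (2 * pi * l * x))) = 0"
      using zero sum_exp_eq_mask_poly[OF B N] by auto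
  qed (use B b in auto)
  then show False by simp
qed

lemma admissible_pair_mask_poly_nonzero:
  assumes "admissible_pair N B"
  shows "\<exists>l::int. mask_poly B ((\<xi> + of_int l) / N) \<noteq> 0"
  using assms spectrum_mask_poly_nonzero admissible_pairD[OF assms]
  unfolding admissible_pair_def by blast

text \<open>If only one frequency class modulo \<open>N\<close> contributes, then \<open>x \<mapsto> e\<^bsup>-2\<pi>i\<xi>x\<^esup>\<close> is, on the support of the
  measure, a multiple of a single element of the orthonormal basis, so the phases coincide.\<close>

lemma admissible_pair_phases_eq:
  assumes adm: "admissible_pair N B"
    and unique: "\<And>l l'::int. mask_poly B ((\<xi> + of_int l) / N) \<noteq> 0 \<Longrightarrow>
      mask_poly B ((\<xi> + of_int l') / N) \<noteq> 0 \<Longrightarrow> N dvd l - l'"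
    and l: "mask_poly B ((\<xi> + of_int l) / N) \<noteq> 0"
    and b: "b \<in> B" "b' \<in> B"
  shows "of_int (b - b') * ((\<xi> + of_int l) / N) \<in> \<int>"
proof -
  define A where "A = (\<lambda>b. inverse (real_of_int N) * real_of_int b) ` B"
  note [simp] = admissible_pairD(2-4)[OF adm]
  have A: "finite A" "A \<noteq> {}"
    by (auto simp: A_def)
  obtain L where L: "is_spectrum (unif_dirac A) (real_of_int ` L)"
    using adm by (auto simp: admissible_pair_def A_def)
  note sum_exp = sum_exp_eq_mask_poly[of B N, folded A_def, simplified]
  obtain l0 where l0: "l0 \<in> L" "mask_poly B ((\<xi> + of_int l0) / N) \<noteq> 0"
    using spectrum_mask_poly_nonzero[of B N L \<xi>] L by (auto simp: A_def)
  \<comment> \<open>The coefficient at the basis element \<open>l0\<close>; all other coefficients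
    turn out to be 0.\<close>
  define m where "m = mask_poly B ((\<xi> + of_int l0) / N)"
  have phase: "iexp (- 2 * pi * \<xi> * x) = m * iexp (2 * pi * of_int l0 * x)" if "x \<in> A" for x
  proof -
    have "iexp (- 2 * pi * \<xi> * x) - m * iexp (2 * pi * of_int l0 * x) = 0"
    proof (rule spectrum_total[OF A L _ _ that])
      show "(\<lambda>x. iexp (- 2 * pi * \<xi> * x) - m * iexp (2 * pi * of_int l0 * x)) \<in> borel_measurable borel"
        by (intro borel_measurable_continuous_onI continuous_intros)
      fix r assume "r \<in> real_of_int ` L"
      then obtain k where k: "k \<in> L" "r = of_int k" by blast
      have "(\<Sum>x\<in>A. (iexp (- 2 * pi * \<xi> * x) - m * iexp (2 * pi * of_int l0 * x)) * cnj (iexp (2 * pi * r * x)))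
          = (\<Sum>x\<in>A. iexp (- 2 * pi * \<xi> * x) * cnj (iexp (2 * pi * of_int k * x)))
            - m * (\<Sum>x\<in>A. iexp (2 * pi * of_int l0 * x) * cnj (iexp (2 * pi * of_int k * x)))"
        by (simp only: k(2) left_diff_distrib sum_subtractf sum_distrib_left mult.assoc)
      also have "\<dots> = 0"
      proof (cases "k = l0")
        case True
        have "(\<Sum>x\<in>A. iexp (2 * pi * of_int l0 * x) * cnj (iexp (2 * pi * of_int l0 * x)))
            = (\<Sum>x\<in>A. 1)"
          by (intro sum.cong refl) (simp add: exp_cnj flip: exp_add)
        moreover have "card A = card B"
          unfolding A_def by (rule card_image) (auto simp: inj_on_def)
        ultimately show ?thesis
          using True sum_exp[of \<xi> l0] by (simp add: m_def mult.commute)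
      next
        case False
        have orth: "(\<Sum>x\<in>A. iexp (2 * pi * of_int l0 * x) * cnj (iexp (2 * pi * of_int k * x))) = 0"
          using spectrum_orthogonal[OF A L, of "of_int l0" "of_int k"] False k(1) l0(1) by auto
        \<comment> \<open>If not, \<open>unique\<close> makes \<open>k\<close> and \<open>l0\<close>
          congruent modulo \<open>N\<close>; the two basis elements then agree on \<open>A\<close>,
          against their orthogonality.\<close>
        have "mask_poly B ((\<xi> + of_int k) / N) = 0"
        proof (rule ccontr)
          assume "mask_poly B ((\<xi> + of_int k) / N) \<noteq> 0"
          from unique[OF l0(2) this] obtain q where q: "l0 = k + N * q"
            by (metis add.commute diff_add_cancel dvd_def)
          have "iexp (2 * pi * of_int l0 * x) * cnj (iexp (2 * pi * of_int k * x)) = 1" if "x \<in> A" for x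
          proof -
            obtain c where c: "x = inverse (real_of_int N) * real_of_int c"
              using \<open>x \<in> A\<close> by (auto simp: A_def)
            have "iexp (2 * pi * of_int l0 * x) * cnj (iexp (2 * pi * of_int k * x))
                = iexp (2 * pi * of_int (q * c))"
              unfolding cnj_iexp iexp_mult by (rule arg_cong[where f = iexp]) (simp add: q c field_simps)
            also have "\<dots> = 1" by (subst iexp_eq_1_iff) simp
            finally show ?thesis .
          qed
          then have "(\<Sum>x\<in>A. iexp (2 * pi * of_int l0 * x) * cnj (iexp (2 * pi * of_int k * x))) = of_nat (card A)"
            by simp
          with orth A show False by simp
        qed
        then show ?thesis
          using orth sum_exp[of \<xi> k] by simp
      qed
      finally show "(\<Sum>x\<in>A. (iexp (- 2 * pi * \<xi> * x) - m * iexp (2 * pi * of_int l0 * x)) * cnj (iexp (2 * pi * r * x))) = 0" .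
    qed
    then show ?thesis by simp
  qed
  define \<eta> where "\<eta> = (\<xi> + of_int l0) / N"
  \<comment> \<open>The left side does not depend on \<open>c\<close>, so all phases
    \<open>c * \<eta>\<close> agree modulo 1.\<close>
  have m: "m = iexp (- (2 * pi * (of_int c * \<eta>)))" if "c \<in> B" for c
  proof -
    let ?x = "inverse (real_of_int N) * real_of_int c"
    have "m = m * iexp (2 * pi * of_int l0 * ?x) * iexp (- (2 * pi * of_int l0 * ?x))"
      unfolding mult.assoc exp_add[symmetric] by simp
    also have "\<dots> = iexp (- 2 * pi * \<xi> * ?x) * iexp (- (2 * pi * of_int l0 * ?x))"
      using that by (subst phase[symmetric]) (auto simp: A_def)
    also have "\<dots> = iexp (- (2 * pi * (of_int c * \<eta>)))"
      unfolding iexp_mult by (rule arg_cong[where f = iexp]) (simp add: \<eta>_def divide_inverse algebra_simps)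
    finally show ?thesis .
  qed
  have "iexp (2 * pi * (of_int (b - b') * \<eta>)) = iexp (- (2 * pi * (of_int b' * \<eta>))) / iexp (- (2 * pi * (of_int b * \<eta>)))"
    unfolding exp_diff[symmetric] by (simp add: algebra_simps)
  also have "\<dots> = 1"
    using m[OF b(1)] m[OF b(2)] by simp
  finally have "of_int (b - b') * \<eta> \<in> \<int>"
    by (simp only: iexp_eq_1_iff)
  \<comment> \<open>Replacing \<open>l0\<close> by the given \<open>l\<close> moves \<eta> by an
    integer only.\<close>
  moreover obtain q where q: "l - l0 = N * q"
    using unique[OF l l0(2)] by (auto simp: dvd_def)
  have "(\<xi> + of_int l) / N = \<eta> + of_int q"
  proof -
    have "real_of_int l = of_int l0 + of_int N * of_int q"
      using q by (simp flip: of_int_mult of_int_add)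
    then show ?thesis by (simp add: \<eta>_def field_simps)
  qed
  then have "of_int (b - b') * ((\<xi> + of_int l) / N) = of_int (b - b') * \<eta> + of_int ((b - b') * q)"
    by (simp add: algebra_simps)
  ultimately show ?thesis
    by simp
qed

section \<open>Sequences of admissible pairs\<close>

lemma discrete_set_subset: "discrete_set T \<Longrightarrow> S \<subseteq> T \<Longrightarrow> discrete_set S"
  unfolding discrete_set_def using islimpt_subset by blast

text \<open>A nonzero element of \<open>D\<close> makes \<open>x\<close> rational, and the
  denominator of \<open>x\<close> in lowest terms divides every element of \<open>D\<close>. This
  needs no Bezout combination, so \<open>D\<close> may be infinite.\<close>

lemma Gcd_eq_1_imp_Ints:
  fixes D :: "int set" and x :: real
  assumes "Gcd D = 1" "\<And>d. d \<in> D \<Longrightarrow> of_int d * x \<in> \<int>"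
  shows "x \<in> \<int>"
proof -
  obtain d where d: "d \<in> D" "d \<noteq> 0"
    using assms(1) by (metis Gcd_0_iff subsetI singletonI zero_neq_one insertCI)
  obtain a where "of_int d * x = of_int a"
    using assms(2)[OF d(1)] by (auto elim: Ints_cases)
  then have "x = of_int a / of_int d"
    using d(2) by (simp add: field_simps)
  then have "x \<in> \<rat>" by simp
  then obtain p q :: int where q: "q > 0" "coprime p q" and x: "x = of_int p / of_int q"
    by (rule Rats_cases')
  have "q dvd e" if e: "e \<in> D" for e
  proof -
    obtain c where "of_int e * x = of_int c"
      using assms(2)[OF e] by (auto elim: Ints_cases)
    then have "real_of_int (e * p) = real_of_int (c * q)"
      using q(1) by (simp add: x field_simps)
    then have "e * p = c * q" by (simp only: of_int_eq_iff)
    then have "q dvd e * p" by simp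
    then show ?thesis
      using q(2) by (simp add: coprime_dvd_mult_left_iff coprime_commute)
  qed
  then have "q dvd Gcd D" by (rule Gcd_greatest)
  with assms(1) q(1) have "q = 1" by simp
  then show ?thesis by (simp add: x)
qed

text \<open>Carries annihilation by \<open>d\<close> back from a point \<eta> to the predecessor
  \<xi>, which is \<open>m * \<eta>\<close> modulo 1.\<close>

lemma Ints_mult_step:
  assumes "of_int m * \<eta> - \<xi> \<in> \<int>" "of_int d * \<eta> \<in> (\<int> :: real set)"
  shows "of_int d * \<xi> \<in> \<int>"
proof -
  have "of_int d * \<xi> = of_int m * (of_int d * \<eta>) - of_int d * (of_int m * \<eta> - \<xi>)"
    by (simp add: algebra_simps)
  then show ?thesis
    using assms by (metis Ints_diff Ints_mult Ints_of_int)
qed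

locale admissible_seq =
  fixes N :: "nat \<Rightarrow> int" and B :: "nat \<Rightarrow> int set"
  assumes adm: "\<And>k. k \<ge> 1 \<Longrightarrow> admissible_pair (N k) (B k)"
    and disc: "discrete_set (\<Union>k\<in>{1..}. (\<lambda>x. real_of_int (N k) * x) ` zeros (mask_poly (B k)))"
begin

lemma pairD: "\<bar>N (Suc k)\<bar> \<ge> 2" "N (Suc k) \<noteq> 0" "finite (B (Suc k))" "B (Suc k) \<noteq> {}"
  using admissible_pairD[OF adm[of "Suc k"]] by auto

lemma real_distribution_tail_factor: "real_distribution (tail_factor N B n j)"
  unfolding tail_factor_def by (rule real_distribution_unif_dirac)

lemma fourier_tail_factor:
  "fourier (tail_factor N B n j) \<xi>
    = mask_poly (B (Suc (n + j))) (\<xi> / of_int (\<Prod>i\<in>{Suc n..Suc (n + j)}. N i))"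
proof -
  have "(\<Prod>i\<in>{Suc n..Suc (n + j)}. N i) \<noteq> 0"
    using pairD(2) by (auto simp: Suc_le_eq gr0_conv_Suc dest!: less_imp_Suc_add)
  from fourier_unif_dirac[OF pairD(3,4) this] show ?thesis
    by (simp add: tail_factor_def)
qed

lemma fourier_tail_factor_Suc:
  "fourier (tail_factor N B n (Suc j)) (of_int (N (Suc n)) * \<xi>) = fourier (tail_factor N B (Suc n) j) \<xi>"
proof -
  have "(\<Prod>i\<in>{Suc n..Suc (n + Suc j)}. N i) = N (Suc n) * (\<Prod>i\<in>{Suc (Suc n)..Suc (Suc n + j)}. N i)"
    by (subst prod.atLeast_Suc_atMost) simp_all
  moreover have "of_int (N (Suc n)) * \<xi> / of_int (N (Suc n) * P) = \<xi> / of_int P" for P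
    using pairD(2)[of n] by simp
  ultimately show ?thesis
    unfolding fourier_tail_factor by (simp only: add_Suc add_Suc_right)
qed

text \<open>The factors of the next tail are the later factors of the present one, dilated by
  \<open>N (Suc n)\<close>.\<close>

lemma partial_conv_tail_factor_Suc:
  "partial_conv (tail_factor N B (Suc n)) m
    = distr (partial_conv (\<lambda>j. tail_factor N B n (Suc j)) m) borel (\<lambda>x. of_int (N (Suc n)) * x)"
proof (rule real_distribution_eqI)
  have dist: "real_distribution (partial_conv (\<lambda>j. tail_factor N B n (Suc j)) m)"
    by (intro real_distribution_partial_conv real_distribution_tail_factor)
  show "real_distribution (distr (partial_conv (\<lambda>j. tail_factor N B n (Suc j)) m) borel
      (\<lambda>x. of_int (N (Suc n)) * x))"
    by (rule real_distribution_distr_mult[OF dist])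
  show "real_distribution (partial_conv (tail_factor N B (Suc n)) m)"
    by (intro real_distribution_partial_conv real_distribution_tail_factor)
  show "fourier (partial_conv (tail_factor N B (Suc n)) m) \<xi>
      = fourier (distr (partial_conv (\<lambda>j. tail_factor N B n (Suc j)) m) borel (\<lambda>x. of_int (N (Suc n)) * x)) \<xi>"
    for \<xi>
    unfolding fourier_distr_mult[OF dist]
    unfolding fourier_eq_char char_partial_conv[OF real_distribution_tail_factor]
    by (intro prod.cong refl fourier_tail_factor_Suc[symmetric, unfolded fourier_eq_char])
qed

text \<open>The first factor is removed by deconvolution and the resulting limit is dilated. This
  yields both the existence of the next tail and the refinement equation.\<close>

lemma infinite_convolution_Suc:
  assumes "is_infinite_convolution (tail_factor N B n) M"
  shows "\<exists>M'. is_infinite_convolution (tail_factor N B (Suc n)) M' \<and>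
    (\<forall>\<xi>. fourier M \<xi> = mask_poly (B (Suc n)) (\<xi> / N (Suc n)) * fourier M' (\<xi> / N (Suc n)))"
proof -
  define A where "A = tail_factor N B n 0"
  define S where "S = partial_conv (\<lambda>j. tail_factor N B n (Suc j))"
  have M: "real_distribution M" and conv: "converges_weakly (partial_conv (tail_factor N B n)) M"
    using assms by (auto simp: is_infinite_convolution_def)
  have A: "real_distribution A" and S: "real_distribution (S m)" for m
    unfolding A_def S_def by (intro real_distribution_partial_conv real_distribution_tail_factor)+
  have AS: "real_distribution (A \<star> S m)" for m
    by (rule real_distribution_convolution[OF A S])
  have fA: "fourier A \<xi> = mask_poly (B (Suc n)) (\<xi> / N (Suc n))" for \<xi>
    by (simp add: A_def fourier_tail_factor)
  have "(\<lambda>m. A \<star> S m) = (\<lambda>m. partial_conv (tail_factor N B n) (Suc m))"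
    unfolding A_def S_def by (rule ext) (rule partial_conv_Suc_left[OF real_distribution_tail_factor, symmetric])
  moreover have "converges_weakly (\<lambda>m. partial_conv (tail_factor N B n) (Suc m)) M"
    unfolding converges_weakly_def
  proof (intro allI impI)
    fix f :: "real \<Rightarrow> real" assume "continuous_on UNIV f \<and> bounded (range f)"
    then have "(\<lambda>m. integral\<^sup>L (partial_conv (tail_factor N B n) m) f) \<longlonglongrightarrow> integral\<^sup>L M f"
      using conv by (simp add: converges_weakly_def)
    then show "(\<lambda>m. integral\<^sup>L (partial_conv (tail_factor N B n) (Suc m)) f) \<longlonglongrightarrow> integral\<^sup>L M f"
      by (rule LIMSEQ_Suc)
  qed
  ultimately have conv': "converges_weakly (\<lambda>m. A \<star> S m) M"
    by simp
  \<comment> \<open>These zeros form one of the sets in the union that \<open>disc\<close> assumes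
    discrete.\<close>
  have "discrete_set (zeros (fourier A))"
  proof (rule discrete_set_subset[OF disc])
    have "\<xi> \<in> (\<lambda>x. real_of_int (N (Suc n)) * x) ` zeros (mask_poly (B (Suc n)))"
      if "fourier A \<xi> = 0" for \<xi>
      using that pairD(2)[of n] by (intro image_eqI[of _ _ "\<xi> / N (Suc n)"]) (auto simp: fA zeros_def)
    then show "zeros (fourier A) \<subseteq> (\<Union>k\<in>{1..}. (\<lambda>x. real_of_int (N k) * x) ` zeros (mask_poly (B k)))"
      by (force simp: zeros_def)
  qed
  then obtain T where T: "real_distribution T" "converges_weakly S T"
    using converges_weakly_deconvolution[OF A S M conv'] by blast
  have "fourier M \<xi> = fourier A \<xi> * fourier T \<xi>" for \<xi>
  proof (rule LIMSEQ_unique)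
    show "(\<lambda>m. fourier (A \<star> S m) \<xi>) \<longlonglongrightarrow> fourier M \<xi>"
      by (rule fourier_tendsto[OF AS M conv'])
    show "(\<lambda>m. fourier (A \<star> S m) \<xi>) \<longlonglongrightarrow> fourier A \<xi> * fourier T \<xi>"
      using tendsto_mult_left[OF fourier_tendsto[OF S T]]
      by (simp add: fourier_eq_char char_convolution[OF A S])
  qed
  moreover define M' where "M' = distr T borel (\<lambda>x. of_int (N (Suc n)) * x)"
  ultimately have "fourier M \<xi> = mask_poly (B (Suc n)) (\<xi> / N (Suc n)) * fourier M' (\<xi> / N (Suc n))" for \<xi>
    using pairD(2)[of n] by (simp add: fA fourier_distr_mult[OF T(1)])
  moreover have "is_infinite_convolution (tail_factor N B (Suc n)) M'"
    unfolding is_infinite_convolution_def M'_def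
    using real_distribution_distr_mult[OF T(1)] converges_weakly_distr_mult[OF S T]
    by (simp add: S_def partial_conv_tail_factor_Suc[abs_def])
  ultimately show ?thesis by blast
qed

lemma is_infinite_convolution_tail:
  assumes "is_infinite_convolution (tail_factor N B 0) \<mu>"
  shows "is_infinite_convolution (tail_factor N B n) (infinite_convolution (tail_factor N B n))"
proof -
  have "\<exists>M. is_infinite_convolution (tail_factor N B n) M"
    using assms infinite_convolution_Suc by (induction n) blast+
  then show ?thesis
    using infinite_convolution_eq by metis
qed

end

section \<open>Zeros of the Fourier transforms of the tails\<close>

text \<open>From here on the measures are replaced by their transforms \<open>F n\<close>. The
  weakly convergent subsequence survives only as \<open>nonzero\<close>: a common zero-free
  neighbourhood of 0 for infinitely many indices.\<close>

locale masked_seq = admissible_seq +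
  fixes F :: "nat \<Rightarrow> real \<Rightarrow> complex"
  assumes refine: "\<And>n \<xi>. F n \<xi> = mask_poly (B (Suc n)) (\<xi> / N (Suc n)) * F (Suc n) (\<xi> / N (Suc n))"
    and nonzero: "\<exists>\<delta>>0. \<forall>n. \<exists>m\<ge>n. \<forall>\<xi>. \<bar>\<xi>\<bar> < \<delta> \<longrightarrow> F m \<xi> \<noteq> 0"
    and at_0: "\<And>n. F n 0 = 1"
begin

definition mask_zeros :: "real set" where
  "mask_zeros = (\<Union>k\<in>{1..}. (\<lambda>x. real_of_int (N k) * x) ` zeros (mask_poly (B k)))"

text \<open>A discrete set that contains the zeros of every \<open>F n\<close>, independently of \<open>n\<close>.\<close>

definition multiples :: "real set" where
  "multiples = {of_int P * x | P x. P \<noteq> 0 \<and> x \<in> mask_zeros}"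

text \<open>\<open>Q\<close> is the product of the \<open>N\<close> passed so far, each at least 2
  in modulus. A vanishing mask on the way would exhibit \<xi> as \<open>Q\<close> times a mask zero,
  so the zero always passes to the next transform.\<close>

lemma zero_descent:
  assumes "F n \<xi> = 0" "\<xi> \<notin> multiples"
  shows "\<exists>Q::int. \<bar>Q\<bar> \<ge> (2::int) ^ m \<and> F (n + m) (\<xi> / Q) = 0"
proof (induction m)
  case 0
  then show ?case
    using assms(1) by (intro exI[of _ 1]) simp
next
  case (Suc m)
  then obtain Q :: int where Q: "\<bar>Q\<bar> \<ge> 2 ^ m" "F (n + m) (\<xi> / Q) = 0"
    by blast
  have "(0::int) < 2 ^ m" by simp
  then have "Q \<noteq> 0" using Q(1) by linarith
  let ?N = "N (Suc (n + m))"
  note N = pairD(1,2)[of "n + m"]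
  have "mask_poly (B (Suc (n + m))) (\<xi> / Q / ?N) \<noteq> 0"
  proof
    assume "mask_poly (B (Suc (n + m))) (\<xi> / Q / ?N) = 0"
    then have "real_of_int ?N * (\<xi> / Q / ?N) \<in> mask_zeros"
      unfolding mask_zeros_def by (intro UN_I[of "Suc (n + m)"] imageI) (simp_all add: zeros_def)
    then have "\<xi> / Q \<in> mask_zeros"
      using N by simp
    then have "of_int Q * (\<xi> / Q) \<in> multiples"
      using \<open>Q \<noteq> 0\<close> unfolding multiples_def by blast
    then show False
      using \<open>Q \<noteq> 0\<close> assms(2) by simp
  qed
  then have "F (n + Suc m) (\<xi> / of_int (Q * ?N)) = 0"
    using Q(2) refine[of "n + m" "\<xi> / Q"] by simp
  moreover have "\<bar>Q * ?N\<bar> \<ge> 2 ^ Suc m"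
    using mult_mono[OF Q(1) N(1)] by (simp add: abs_mult mult.commute)
  ultimately show ?case by blast
qed

lemma zeros_subset_multiples:
  assumes "F n \<xi> = 0"
  shows "\<xi> \<in> multiples"
proof (rule ccontr)
  assume nin: "\<xi> \<notin> multiples"
  obtain \<delta> where \<delta>: "\<delta> > 0" "\<And>n. \<exists>m\<ge>n. \<forall>\<xi>. \<bar>\<xi>\<bar> < \<delta> \<longrightarrow> F m \<xi> \<noteq> 0"
    using nonzero by blast
  \<comment> \<open>After at least \<open>k\<close> steps the descended zero lies within \<delta> of
    0; \<open>m\<close> is a later index at which this is impossible.\<close>
  obtain k where k: "\<bar>\<xi>\<bar> / \<delta> < 2 ^ k"
    using real_arch_pow[of 2 "\<bar>\<xi>\<bar> / \<delta>"] by auto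
  obtain m where m: "m \<ge> n + k" "\<And>\<xi>. \<bar>\<xi>\<bar> < \<delta> \<Longrightarrow> F m \<xi> \<noteq> 0"
    using \<delta>(2)[of "n + k"] by blast
  obtain Q :: int where Q: "\<bar>Q\<bar> \<ge> 2 ^ (m - n)" "F (n + (m - n)) (\<xi> / Q) = 0"
    using zero_descent[OF assms nin] by blast
  have "(2::real) ^ k \<le> 2 ^ (m - n)"
    using m(1) by (intro power_increasing) auto
  also have "\<dots> \<le> \<bar>real_of_int Q\<bar>"
    using Q(1) by (metis of_int_abs of_int_le_iff of_int_numeral of_int_power)
  finally have "\<bar>\<xi>\<bar> / \<delta> < \<bar>real_of_int Q\<bar>"
    using k by simp
  moreover from this have "\<bar>real_of_int Q\<bar> > 0"
    using \<delta>(1) by (smt (verit) divide_nonneg_pos)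
  ultimately have "\<bar>\<xi> / Q\<bar> < \<delta>"
    using \<delta>(1) by (simp add: field_simps)
  then show False
    using m Q(2) by simp
qed

lemma finite_multiples: "finite (multiples \<inter> {0..<1})"
proof -
  have d: "discrete_set mask_zeros"
    using disc by (simp add: mask_zeros_def)
  \<comment> \<open>Masks equal 1 at 0. With discreteness this keeps the mask zeros at distance at
    least \<open>c\<close> from 0, which bounds the multiplier by 1/c; as the multiplier is a
    nonzero integer, the mask zero itself lies in [-1, 1].\<close>
  have "0 \<notin> mask_zeros"
  proof
    assume "0 \<in> mask_zeros"
    then obtain k x where k: "k \<ge> 1" "x \<in> zeros (mask_poly (B k))" "real_of_int (N k) * x = 0"
      by (auto simp: mask_zeros_def)
    with admissible_pairD[OF adm[OF k(1)]] show False
      by (auto simp: zeros_def mask_poly_0)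
  qed
  moreover have "\<not> 0 islimpt mask_zeros"
    using d by (simp add: discrete_set_def)
  ultimately obtain c where c: "c > 0" "\<And>x. x \<in> mask_zeros \<Longrightarrow> \<bar>x\<bar> \<ge> c"
    unfolding islimpt_approachable by (force simp: not_less)
  have "finite ({-1..1} \<inter> mask_zeros)"
    using d by (simp add: discrete_set_iff)
  moreover have "multiples \<inter> {0..<1} \<subseteq> (\<lambda>(P, x). real_of_int P * x) ` ({- \<lceil>1 / c\<rceil>..\<lceil>1 / c\<rceil>} \<times> ({-1..1} \<inter> mask_zeros))"
  proof
    fix y assume "y \<in> multiples \<inter> {0..<1}"
    then obtain P :: int and x where y: "y = of_int P * x" "P \<noteq> 0" "x \<in> mask_zeros" "\<bar>of_int P * x\<bar> \<le> 1"
      by (auto simp: multiples_def)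
    have "\<bar>real_of_int P\<bar> * c \<le> \<bar>real_of_int P\<bar> * \<bar>x\<bar>"
      using c(2)[OF y(3)] by (intro mult_left_mono) auto
    then have "\<bar>real_of_int P\<bar> \<le> 1 / c"
      using y(4) c(1) by (simp add: abs_mult field_simps)
    then have "P \<in> {- \<lceil>1 / c\<rceil>..\<lceil>1 / c\<rceil>}"
      by (auto; linarith)
    moreover have "1 * \<bar>x\<bar> \<le> \<bar>real_of_int P\<bar> * \<bar>x\<bar>"
      using y(2) by (intro mult_right_mono) linarith+
    then have "x \<in> {-1..1}"
      using y(4) by (auto simp: abs_mult)
    ultimately show "y \<in> (\<lambda>(P, x). real_of_int P * x) ` ({- \<lceil>1 / c\<rceil>..\<lceil>1 / c\<rceil>} \<times> ({-1..1} \<inter> mask_zeros))"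
      using y by force
  qed
  ultimately show ?thesis
    by (meson finite_SigmaI finite_atLeastAtMost_int finite_imageI finite_subset)
qed

section \<open>Periodic zeros modulo 1 and their number\<close>

definition periodic_zeros :: "nat \<Rightarrow> real set" where
  "periodic_zeros n = {\<xi> \<in> {0..<1}. \<forall>k::int. F n (\<xi> + of_int k) = 0}"

lemma periodic_zeros_subset: "periodic_zeros n \<subseteq> multiples \<inter> {0..<1}"
  using zeros_subset_multiples by (force simp: periodic_zeros_def dest: spec[of _ 0])

lemma finite_periodic_zeros: "finite (periodic_zeros n)"
  using finite_multiples periodic_zeros_subset by (rule rev_finite_subset)

lemma frac_periodic_zeros:
  assumes "\<And>k::int. F n (\<xi> + of_int k) = 0"
  shows "frac \<xi> \<in> periodic_zeros n"
proof -
  have "F n (frac \<xi> + of_int k) = 0" for k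
    using assms[of "k - \<lfloor>\<xi>\<rfloor>"] by (simp add: frac_def algebra_simps)
  then show ?thesis
    by (simp add: periodic_zeros_def frac_lt_1)
qed

text \<open>Changing \<open>l\<close> by multiples of \<open>N (Suc n)\<close> shifts the quotient
  by integers and leaves the mask unchanged. The mask factor is thus nonzero along the whole class,
  and the other factor must vanish there.\<close>

lemma periodic_zeros_Suc:
  assumes "\<xi> \<in> periodic_zeros n" "mask_poly (B (Suc n)) ((\<xi> + of_int l) / N (Suc n)) \<noteq> 0"
  shows "frac ((\<xi> + of_int l) / N (Suc n)) \<in> periodic_zeros (Suc n)"
proof (rule frac_periodic_zeros)
  fix k :: int
  have "(\<xi> + of_int (l + N (Suc n) * k)) / N (Suc n) = (\<xi> + of_int l) / N (Suc n) + of_int k"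
    using pairD(2)[of n] by (simp add: field_simps)
  moreover have "F n (\<xi> + of_int (l + N (Suc n) * k)) = 0"
    using assms(1) unfolding periodic_zeros_def by blast
  ultimately show "F (Suc n) ((\<xi> + of_int l) / N (Suc n) + of_int k) = 0"
    using refine[of n "\<xi> + of_int (l + N (Suc n) * k)"] assms(2) by (simp add: mask_poly_add_int)
qed

text \<open>A successor determines its predecessor: multiplication by \<open>N (Suc n)\<close>
  modulo 1 recovers \<xi>.\<close>

lemma frac_mult_frac:
  assumes "\<xi> \<in> {0..<1}"
  shows "frac (of_int (N (Suc n)) * frac ((\<xi> + of_int l) / N (Suc n))) = \<xi>"
proof -
  have "of_int (N (Suc n)) * frac ((\<xi> + of_int l) / N (Suc n)) - \<xi>
      = of_int (l - N (Suc n) * \<lfloor>(\<xi> + of_int l) / N (Suc n)\<rfloor>)"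
    using pairD(2)[of n] by (simp add: frac_def field_simps)
  then have "of_int (N (Suc n)) * frac ((\<xi> + of_int l) / N (Suc n)) - \<xi> \<in> \<int>"
    by (metis Ints_of_int)
  then show ?thesis
    using assms unfolding frac_unique_iff by simp
qed

text \<open>This makes the cardinality of \<open>periodic_zeros n\<close> nondecreasing; once it is constant, the map
  \<open>\<eta> \<mapsto> N\<^sub>n\<^sub>+\<^sub>1 \<eta> mod 1\<close> is injective and each periodic zero has only one successor.\<close>

lemma periodic_zeros_subset_image:
  "periodic_zeros n \<subseteq> (\<lambda>\<eta>. frac (of_int (N (Suc n)) * \<eta>)) ` periodic_zeros (Suc n)"
proof
  fix \<xi> assume \<xi>: "\<xi> \<in> periodic_zeros n"
  obtain l where "mask_poly (B (Suc n)) ((\<xi> + of_int l) / N (Suc n)) \<noteq> 0"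
    using admissible_pair_mask_poly_nonzero[OF adm] by force
  then show "\<xi> \<in> (\<lambda>\<eta>. frac (of_int (N (Suc n)) * \<eta>)) ` periodic_zeros (Suc n)"
    by (intro rev_image_eqI[OF periodic_zeros_Suc[OF \<xi>]] frac_mult_frac[symmetric])
      (use \<xi> in \<open>auto simp: periodic_zeros_def\<close>)
qed

lemma card_periodic_zeros_Suc: "card (periodic_zeros n) \<le> card (periodic_zeros (Suc n))"
  using surj_card_le[OF finite_periodic_zeros periodic_zeros_subset_image] .

lemma periodic_zeros_nonempty:
  "periodic_zeros 0 \<noteq> {} \<Longrightarrow> periodic_zeros n \<noteq> {}"
  using periodic_zeros_subset_image by (induction n) blast+

text \<open>The cardinalities are nondecreasing and bounded by that of one finite set;
  \<open>n0\<close> is an index where their maximum is attained.\<close>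

lemma card_periodic_zeros_eventually_const:
  "\<exists>n0. \<forall>n\<ge>n0. card (periodic_zeros n) = card (periodic_zeros n0)"
proof -
  have "finite (range (\<lambda>n. card (periodic_zeros n)))"
    by (rule finite_subset[of _ "{..card (multiples \<inter> {0..<1})}"])
      (auto intro!: card_mono finite_multiples periodic_zeros_subset[THEN subsetD])
  then have "Max (range (\<lambda>n. card (periodic_zeros n))) \<in> range (\<lambda>n. card (periodic_zeros n))"
    by (intro Max_in) auto
  then obtain n0 where n0: "Max (range (\<lambda>n. card (periodic_zeros n))) = card (periodic_zeros n0)"
    by blast
  have "card (periodic_zeros n) = card (periodic_zeros n0)" if "n \<ge> n0" for n
  proof (rule antisym)
    show "card (periodic_zeros n) \<le> card (periodic_zeros n0)"
      unfolding n0[symmetric] by (rule Max_ge) (use \<open>finite _\<close> in auto)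
    show "card (periodic_zeros n0) \<le> card (periodic_zeros n)"
      using that by (rule lift_Suc_mono_le[of "\<lambda>n. card (periodic_zeros n)", OF card_periodic_zeros_Suc])
  qed
  then show ?thesis by blast
qed

text \<open>Equal cardinalities make the surjection back to level \<open>n\<close> injective, so all
  successors of \<xi> coincide. The contributing \<open>l\<close> are then congruent modulo
  \<open>N (Suc n)\<close>, as the lemma on phases requires.\<close>

lemma stable_step:
  assumes card: "card (periodic_zeros (Suc n)) = card (periodic_zeros n)" and \<xi>: "\<xi> \<in> periodic_zeros n"
  shows "\<exists>\<eta>\<in>periodic_zeros (Suc n). of_int (N (Suc n)) * \<eta> - \<xi> \<in> \<int> \<and>
    (\<forall>b\<in>B (Suc n). \<forall>b'\<in>B (Suc n). of_int (b - b') * \<eta> \<in> \<int>)"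
proof -
  let ?N = "N (Suc n)" and ?B = "B (Suc n)"
  let ?\<psi> = "\<lambda>\<eta>. frac (of_int ?N * \<eta>)"
  have \<xi>01: "\<xi> \<in> {0..<1}"
    using \<xi> by (simp add: periodic_zeros_def)
  have "card (?\<psi> ` periodic_zeros (Suc n)) = card (periodic_zeros (Suc n))"
  proof (rule antisym)
    show "card (periodic_zeros (Suc n)) \<le> card (?\<psi> ` periodic_zeros (Suc n))"
      unfolding card by (intro card_mono finite_imageI finite_periodic_zeros periodic_zeros_subset_image)
  qed (intro card_image_le finite_periodic_zeros)
  then have inj: "inj_on ?\<psi> (periodic_zeros (Suc n))"
    by (rule eq_card_imp_inj_on[OF finite_periodic_zeros])
  have unique: "?N dvd l - l'"
    if "mask_poly ?B ((\<xi> + of_int l) / ?N) \<noteq> 0" "mask_poly ?B ((\<xi> + of_int l') / ?N) \<noteq> 0" for l l' :: int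
  proof -
    have "frac ((\<xi> + of_int l) / ?N) = frac ((\<xi> + of_int l') / ?N)"
      by (rule inj_onD[OF inj]) (simp_all only: frac_mult_frac[OF \<xi>01] periodic_zeros_Suc[OF \<xi> that(1)]
        periodic_zeros_Suc[OF \<xi> that(2)])
    then have "(\<xi> + of_int l) / ?N - (\<xi> + of_int l') / ?N
        = of_int (\<lfloor>(\<xi> + of_int l) / ?N\<rfloor> - \<lfloor>(\<xi> + of_int l') / ?N\<rfloor>)"
      by (simp add: frac_def algebra_simps)
    then obtain q :: int where "(\<xi> + of_int l) / ?N - (\<xi> + of_int l') / ?N = of_int q"
      by blast
    then have "real_of_int (l - l') = of_int (?N * q)"
      unfolding diff_divide_distrib[symmetric] using pairD(2)[of n] by (simp add: divide_eq_eq mult.commute)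
    then show ?thesis
      by (simp only: of_int_eq_iff) simp
  qed
  obtain l where l: "mask_poly ?B ((\<xi> + of_int l) / ?N) \<noteq> 0"
    using admissible_pair_mask_poly_nonzero[OF adm] by force
  define \<eta> where "\<eta> = (\<xi> + of_int l) / ?N"
  have N\<eta>: "of_int ?N * \<eta> = \<xi> + of_int l"
    using pairD(2)[of n] by (simp add: \<eta>_def)
  have \<eta>: "frac \<eta> = \<eta> - of_int \<lfloor>\<eta>\<rfloor>"
    by (simp add: frac_def)
  \<comment> \<open>The witness is the fractional part of \<eta>; dropping the integer part affects
    neither integrality claim.\<close>
  show ?thesis
  proof (intro bexI conjI ballI)
    show "frac \<eta> \<in> periodic_zeros (Suc n)"
      unfolding \<eta>_def by (rule periodic_zeros_Suc[OF \<xi> l])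
    have "of_int ?N * frac \<eta> - \<xi> = of_int (l - ?N * \<lfloor>\<eta>\<rfloor>)"
      unfolding \<eta> right_diff_distrib N\<eta> by simp
    then show "of_int ?N * frac \<eta> - \<xi> \<in> \<int>"
      by (metis Ints_of_int)
    fix b b' assume "b \<in> ?B" "b' \<in> ?B"
    then have "of_int (b - b') * \<eta> \<in> \<int>"
      unfolding \<eta>_def by (intro admissible_pair_phases_eq[OF adm unique l]) auto
    then have "of_int (b - b') * \<eta> - of_int ((b - b') * \<lfloor>\<eta>\<rfloor>) \<in> \<int>"
      by (rule Ints_diff) simp
    moreover have "of_int (b - b') * frac \<eta> = of_int (b - b') * \<eta> - of_int ((b - b') * \<lfloor>\<eta>\<rfloor>)"
      unfolding \<eta> by (simp add: algebra_simps)
    ultimately show "of_int (b - b') * frac \<eta> \<in> \<int>" by simp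
  qed
qed

text \<open>A chain of \<open>k + 1\<close> successors leads from \<xi> to level
  \<open>Suc (n + k)\<close>, where the phases agree; the integrality is then carried back along the
  chain. Hence \<xi> and \<open>n\<close> vary in the induction.\<close>

lemma differences_annihilate:
  assumes n0: "\<And>n. n \<ge> n0 \<Longrightarrow> card (periodic_zeros n) = card (periodic_zeros n0)"
    and "n \<ge> n0" "\<xi> \<in> periodic_zeros n" "b \<in> B (Suc (n + k))" "b' \<in> B (Suc (n + k))"
  shows "of_int (b - b') * \<xi> \<in> \<int>"
  using assms(2-)
proof (induction k arbitrary: n \<xi>)
  case 0
  obtain \<eta> where "of_int (N (Suc n)) * \<eta> - \<xi> \<in> \<int>" "of_int (b - b') * \<eta> \<in> \<int>"
    using stable_step[of n \<xi>] n0[of n] n0[of "Suc n"] 0 by auto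
  then show ?case by (rule Ints_mult_step)
next
  case (Suc k)
  obtain \<eta> where \<eta>: "\<eta> \<in> periodic_zeros (Suc n)" "of_int (N (Suc n)) * \<eta> - \<xi> \<in> \<int>"
    using stable_step[of n \<xi>] n0[of n] n0[of "Suc n"] Suc.prems by auto
  moreover have "of_int (b - b') * \<eta> \<in> \<int>"
    using Suc.prems \<eta>(1) by (intro Suc.IH[of "Suc n"]) auto
  ultimately show ?case by (blast intro: Ints_mult_step)
qed

lemma no_periodic_zeros:
  assumes gcd: "\<And>k. k \<ge> 1 \<Longrightarrow> Gcd (\<Union>j\<in>{k..}. {b - b' | b b'. b \<in> B j \<and> b' \<in> B j}) = 1"
  shows "\<exists>k::int. F 0 (\<xi> + of_int k) \<noteq> 0"
proof (rule ccontr)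
  assume "\<not> ?thesis"
  then have ne: "periodic_zeros n \<noteq> {}" for n
    using frac_periodic_zeros periodic_zeros_nonempty by blast
  obtain n0 where n0: "\<And>n. n \<ge> n0 \<Longrightarrow> card (periodic_zeros n) = card (periodic_zeros n0)"
    using card_periodic_zeros_eventually_const by blast
  obtain \<eta> where \<eta>: "\<eta> \<in> periodic_zeros n0"
    using ne[of n0] by blast
  have "\<eta> \<in> \<int>"
  \<comment> \<open>The gcd condition is used from index \<open>Suc n0\<close> on, exactly the range
    in which differences are known to annihilate \<eta>.\<close>
  proof (rule Gcd_eq_1_imp_Ints[OF gcd])
    fix d assume "d \<in> (\<Union>j\<in>{Suc n0..}. {b - b' | b b'. b \<in> B j \<and> b' \<in> B j})"
    then obtain j b b' where d: "j \<ge> Suc n0" "d = b - b'" "b \<in> B j" "b' \<in> B j"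
      by auto
    moreover from d(1) have "j = Suc (n0 + (j - Suc n0))" by simp
    ultimately show "of_int d * \<eta> \<in> \<int>"
      using differences_annihilate[OF n0 order_refl \<eta>] by metis
  qed simp
  then obtain k where "\<eta> = of_int k"
    by (auto elim: Ints_cases)
  moreover have "F n0 (\<eta> + of_int (- k)) = 0"
    using \<eta> unfolding periodic_zeros_def by blast
  ultimately show False
    using at_0[of n0] by simp
qed

end

section \<open>Integral periodic zeros of the infinite convolution\<close>

theorem theorem1p3:
  fixes N :: "nat \<Rightarrow> int" and B :: "nat \<Rightarrow> int set"
    and \<mu> :: "real measure" and \<nu> :: "nat \<Rightarrow> real measure"
  assumes "\<And>k. k \<ge> 1 \<Longrightarrow> admissible_pair (N k) (B k)"
    and "is_infinite_convolution (tail_factor N B 0) \<mu>"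
    and "\<And>n. n \<ge> 1 \<Longrightarrow> \<nu> n = infinite_convolution (tail_factor N B n)"
    and "\<exists>(r :: nat \<Rightarrow> nat) \<rho>. strict_mono r \<and> (\<forall>j. r j \<ge> 1) \<and>
           real_distribution \<rho> \<and> converges_weakly (\<lambda>j. \<nu> (r j)) \<rho>"
    and "discrete_set (\<Union>k\<in>{1..}. (\<lambda>x. real_of_int (N k) * x) ` zeros (mask_poly (B k)))"
    and "\<And>k. k \<ge> 1 \<Longrightarrow> Gcd (\<Union>j\<in>{k..}. {b - b' | b b'. b \<in> B j \<and> b' \<in> B j}) = 1"
  shows "integral_periodic_zeros \<mu> = {}"
proof -
  interpret admissible_seq N B
    using assms(1,5) by unfold_locales
  \<comment> \<open>Extends \<nu> to index 0, where it is \<mu>, so that the refinement equation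
    holds from the start.\<close>
  define M where "M n = infinite_convolution (tail_factor N B n)" for n
  have M: "is_infinite_convolution (tail_factor N B n) (M n)" for n
    unfolding M_def by (rule is_infinite_convolution_tail[OF assms(2)])
  then have dist: "real_distribution (M n)" for n
    by (simp add: is_infinite_convolution_def)
  have M0: "M 0 = \<mu>"
    unfolding M_def by (rule infinite_convolution_eq[OF assms(2)])
  obtain r \<rho> where r: "strict_mono r" "\<And>j. r j \<ge> 1" "real_distribution \<rho>" "converges_weakly (\<lambda>j. M (r j)) \<rho>"
    using assms(3,4) by (auto simp: M_def)
  interpret masked_seq N B "\<lambda>n. fourier (M n)"
  proof
    fix n \<xi>
    show "fourier (M n) \<xi> = mask_poly (B (Suc n)) (\<xi> / N (Suc n)) * fourier (M (Suc n)) (\<xi> / N (Suc n))"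
      using infinite_convolution_Suc[OF M[of n]] infinite_convolution_eq by (metis M_def)
    show "fourier (M n) 0 = 1"
      using real_distribution.char_zero[OF dist] by (simp add: fourier_eq_char)
  next
    have "tight (\<lambda>j. M (r j))"
      by (rule converges_weakly_imp_tight[OF dist r(3,4)])
    then obtain \<delta> where "\<delta> > 0" "\<And>j \<xi>. \<bar>\<xi>\<bar> < \<delta> \<Longrightarrow> fourier (M (r j)) \<xi> \<noteq> 0"
      using tight_fourier_nonzero by blast
    \<comment> \<open>Strict monotonicity gives r n \<ge> n, so \<open>m = r n\<close>
      serves.\<close>
    then show "\<exists>\<delta>>0. \<forall>n. \<exists>m\<ge>n. \<forall>\<xi>. \<bar>\<xi>\<bar> < \<delta> \<longrightarrow> fourier (M m) \<xi> \<noteq> 0"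
      using seq_suble[OF r(1)] by metis
  qed
  show ?thesis
    using no_periodic_zeros[OF assms(6)] by (auto simp: integral_periodic_zeros_def M0)
qed

end
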